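(* Let $H$ be a finite-dimensional Hopf algebra over $\mathbb{C}$, and let $V$ be a $\pi_2$-injective vertex algebra over $\mathbb{C}$, i.e. a vertex algebra such that the linear map $\pi_2^V: V\otimes V\to V((z))$, $u\otimes v\mapsto Y(u,z)v$, is injective. Assume that $V$ is an inner faithful $H$-module vertex algebra. Then $H$ is (isomorphic as a Hopf algebra to) a group algebra.
   Context: All vector spaces and tensor products are over $\mathbb{C}$. A vertex algebra is a vector space $V$ with a vacuum vector $\mathbf{1}\in V$ and a linear map $Y(\cdot,z): V\to \mathrm{End}_{\mathbb{C}}(V)[[z,z^{-1}]]$, $v\mapsto Y(v,z)=\sum_{n\in\mathbb{Z}} v_n z^{-n-1}$, such that: for $u,v\in V$, $u_nv=0$ for $n$ sufficiently large; $Y(\mathbf{1},z)=\mathrm{Id}_V$; $Y(u,z)\mathbf{1}\in u+zV[[z]]$; and the Jacobi identity $$z_0^{-1}\delta\left(\tfrac{z_1-z_2}{z_0}\right)Y(u,z_1)Y(v,z_2)-z_0^{-1}\delta\left(\tfrac{z_2-z_1}{-z_0}\right)Y(v,z_2)Y(u,z_1)=z_2^{-1}\delta\left(\tfrac{z_1-z_0}{z_2}\right)Y(Y(u,z_0)v,z_2)$$ holds, where $\delta(z)=\sum_{n\in\mathbb{Z}}z^n$ and binomials are expanded in nonnegative integral powers of the second variable. No grading or conformal vector is assumed. Sweedler notation: $\Delta(h)=\sum h_1\otimes h_2$; $\epsilon$ is the counit. A vertex algebra $V$ is an $H$-module vertex algebra if $V$ is an $H$-module, $h\mathbf{1}=\epsilon(h)\mathbf{1}$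 for all $h\in H$, and $h(Y(u,z)v)=\sum Y(h_1u,z)h_2v$ for all $h\in H$, $u,v\in V$. A Hopf ideal of $H$ is a two-sided ideal $I$ with $\Delta(I)\subseteq H\otimes I+I\otimes H$, $\epsilon(I)=0$ and $S(I)\subseteq I$ ($S$ the antipode). The action of $H$ on $V$ is inner faithful if $IV\neq 0$ for every nonzero Hopf ideal $I$ of $H$. *)

theory Defs
  imports Complex_Main "HOL-Library.Poly_Mapping" "HOL-Algebra.Group"
begin

class complex_vector = ab_group_add +
  fixes scaleC :: "complex \<Rightarrow> 'a \<Rightarrow> 'a" (infixr \<open>*\<^sub>C\<close> 75)
  assumes scaleC_add_right: "a *\<^sub>C (x + y) = a *\<^sub>C x + a *\<^sub>C y"
    and scaleC_add_left: "(a + b) *\<^sub>C x = a *\<^sub>C x + b *\<^sub>C x"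
    and scaleC_scaleC: "a *\<^sub>C b *\<^sub>C x = (a * b) *\<^sub>C x"
    and scaleC_one: "1 *\<^sub>C x = x"

global_interpretation complex_vector: vector_space "scaleC :: complex \<Rightarrow> 'a \<Rightarrow> 'a::complex_vector"
  by unfold_locales (rule scaleC_add_right scaleC_add_left scaleC_scaleC scaleC_one)+

abbreviation cspan :: "'a::complex_vector set \<Rightarrow> 'a set"
  where "cspan \<equiv> module.span scaleC"

abbreviation csubspace :: "'a::complex_vector set \<Rightarrow> bool"
  where "csubspace \<equiv> module.subspace scaleC"

abbreviation clinear :: "('a::complex_vector \<Rightarrow> 'b::complex_vector) \<Rightarrow> bool"
  where "clinear \<equiv> Vector_Spaces.linear scaleC scaleC"

definition cbilinear :: "('a::complex_vector \<Rightarrow> 'b::complex_vector \<Rightarrow> 'c::complex_vector) \<Rightarrow> bool"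
  where "cbilinear f \<longleftrightarrow> (\<forall>a. clinear (\<lambda>b. f a b)) \<and> (\<forall>b. clinear (\<lambda>a. f a b))"

lemma clinearI:
  assumes "\<And>x y. f (x + y) = f x + f y" "\<And>c x. f (c *\<^sub>C x) = c *\<^sub>C f x"
  shows "clinear f"
  using assms by unfold_locales auto

lemma clinear_add: "clinear f \<Longrightarrow> f (x + y) = f x + f y"
  and clinear_scale: "clinear f \<Longrightarrow> f (c *\<^sub>C x) = c *\<^sub>C f x"
  by (simp_all add: Vector_Spaces.linear_def module_hom_def module_hom_axioms_def)

class complex_algebra_1 = complex_vector + ring_1 +
  assumes mult_scaleC_left: "(a *\<^sub>C x) * y = a *\<^sub>C (x * y)"
    and mult_scaleC_right: "x * (a *\<^sub>C y) = a *\<^sub>C (x * y)"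

instantiation complex :: complex_algebra_1
begin
definition scaleC_complex :: "complex \<Rightarrow> complex \<Rightarrow> complex" where "scaleC_complex = (*)"
instance by standard (simp_all add: scaleC_complex_def algebra_simps)
end

instantiation poly_mapping :: (type, complex_vector) complex_vector
begin
definition scaleC_poly_mapping :: "complex \<Rightarrow> ('a \<Rightarrow>\<^sub>0 'b) \<Rightarrow> 'a \<Rightarrow>\<^sub>0 'b"
  where "scaleC_poly_mapping c = Poly_Mapping.map (scaleC c)"

lemma lookup_scaleC: "Poly_Mapping.lookup (c *\<^sub>C p) x = c *\<^sub>C Poly_Mapping.lookup p x"
  for p :: "'a \<Rightarrow>\<^sub>0 'b"
  by (simp add: scaleC_poly_mapping_def map.rep_eq when_def)

instance
  by standard
    (simp_all add: poly_mapping_eq_iff fun_eq_iff lookup_scaleC lookup_add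
      scaleC_add_right scaleC_add_left scaleC_scaleC scaleC_one)
end

definition tensor_relators :: "(('a::complex_vector \<times> 'b::complex_vector) \<Rightarrow>\<^sub>0 complex) set"
  where "tensor_relators =
    (let s = (\<lambda>a b. Poly_Mapping.single (a, b) (1::complex)) in
      {s (a + a') b - s a b - s a' b | a a' b. True} \<union>
      {s a (b + b') - s a b - s a b' | a b b'. True} \<union>
      {s (c *\<^sub>C a) b - c *\<^sub>C s a b | c a b. True} \<union>
      {s a (c *\<^sub>C b) - c *\<^sub>C s a b | c a b. True})"

definition tensor_equiv ::
  "(('a::complex_vector \<times> 'b::complex_vector) \<Rightarrow>\<^sub>0 complex) \<Rightarrow> (('a \<times> 'b) \<Rightarrow>\<^sub>0 complex) \<Rightarrow> bool"
  where "tensor_equiv p q \<longleftrightarrow> p - q \<in> cspan tensor_relators"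

lemma equivp_tensor_equiv: "equivp tensor_equiv"
proof (rule equivpI)
  show "reflp tensor_equiv"
    by (simp add: reflp_def tensor_equiv_def complex_vector.span_zero)
  show "symp tensor_equiv"
    unfolding symp_def tensor_equiv_def
    using complex_vector.span_neg[of "_ - _" tensor_relators] by fastforce
  show "transp tensor_equiv"
    unfolding transp_def tensor_equiv_def
    using complex_vector.span_add[of "_ - _" tensor_relators "_ - _"] by fastforce
qed

quotient_type (overloaded) ('a, 'b) tensor =
  "('a::complex_vector \<times> 'b::complex_vector) \<Rightarrow>\<^sub>0 complex" / tensor_equiv
  by (rule equivp_tensor_equiv)

instantiation tensor :: (complex_vector, complex_vector) complex_vector
begin

lift_definition zero_tensor :: "('a, 'b) tensor" is 0 .

lift_definition plus_tensor :: "('a, 'b) tensor \<Rightarrow> ('a, 'b) tensor \<Rightarrow> ('a, 'b) tensor" is "(+)"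
  unfolding tensor_equiv_def by (simp only: add_diff_add complex_vector.span_add)

lift_definition minus_tensor :: "('a, 'b) tensor \<Rightarrow> ('a, 'b) tensor \<Rightarrow> ('a, 'b) tensor" is "(-)"
  unfolding tensor_equiv_def
  by (drule (1) complex_vector.span_diff) (simp add: algebra_simps)

lift_definition uminus_tensor :: "('a, 'b) tensor \<Rightarrow> ('a, 'b) tensor" is uminus
  unfolding tensor_equiv_def by (simp only: minus_diff_minus complex_vector.span_neg)

lift_definition scaleC_tensor :: "complex \<Rightarrow> ('a, 'b) tensor \<Rightarrow> ('a, 'b) tensor" is scaleC
  unfolding tensor_equiv_def
  by (simp only: complex_vector.span_scale complex_vector.scale_right_diff_distrib[symmetric])

instance
  by standard
    (transfer, simp add: tensor_equiv_def complex_vector.span_zero algebra_simps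
      scaleC_add_right scaleC_add_left scaleC_scaleC scaleC_one)+

end

lift_definition tensor :: "'a::complex_vector \<Rightarrow> 'b::complex_vector \<Rightarrow> ('a, 'b) tensor"
    (infixr \<open>\<otimes>\<^sub>C\<close> 72)
  is "\<lambda>a b. Poly_Mapping.single (a, b) 1" .

text \<open>The linear map induced by a bilinear map, computed on a representative
  (see \<open>tensor_lift_tensor\<close> and \<open>clinear_tensor_lift\<close>; meaningful for bilinear \<open>f\<close> only).
  It renders Sweedler notation: \<open>tensor_lift f (\<Delta> h)\<close> is the sum of all \<open>f h1 h2\<close>.\<close>

definition free_lift ::
  "('a \<Rightarrow> 'b \<Rightarrow> 'c::complex_vector) \<Rightarrow> (('a \<times> 'b) \<Rightarrow>\<^sub>0 complex) \<Rightarrow> 'c"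
  where "free_lift f p =
    (\<Sum>(a, b)\<in>Poly_Mapping.keys p. Poly_Mapping.lookup p (a, b) *\<^sub>C f a b)"

definition tensor_lift ::
  "('a::complex_vector \<Rightarrow> 'b::complex_vector \<Rightarrow> 'c::complex_vector) \<Rightarrow> ('a, 'b) tensor \<Rightarrow> 'c"
  where "tensor_lift f t = free_lift f (rep_tensor t)"

lemma free_lift_superset:
  assumes "finite A" "Poly_Mapping.keys p \<subseteq> A"
  shows "free_lift f p = (\<Sum>(a, b)\<in>A. Poly_Mapping.lookup p (a, b) *\<^sub>C f a b)"
  unfolding free_lift_def using assms
  by (intro sum.mono_neutral_left) (auto simp: in_keys_iff)

lemma clinear_free_lift: "clinear (free_lift f)"
proof (rule clinearI)
  fix p q :: "('a \<times> 'b) \<Rightarrow>\<^sub>0 complex" and c :: complex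
  let ?A = "Poly_Mapping.keys p \<union> Poly_Mapping.keys q"
  have "free_lift f (p + q) = (\<Sum>(a, b)\<in>?A. Poly_Mapping.lookup (p + q) (a, b) *\<^sub>C f a b)"
    using Poly_Mapping.keys_add[of p q] by (intro free_lift_superset) auto
  also have "\<dots> = (\<Sum>(a, b)\<in>?A. Poly_Mapping.lookup p (a, b) *\<^sub>C f a b)
      + (\<Sum>(a, b)\<in>?A. Poly_Mapping.lookup q (a, b) *\<^sub>C f a b)"
    by (simp add: lookup_add scaleC_add_left sum.distrib case_prod_unfold)
  also have "\<dots> = free_lift f p + free_lift f q"
    by (simp add: free_lift_superset[of ?A])
  finally show "free_lift f (p + q) = free_lift f p + free_lift f q" .
  have "free_lift f (c *\<^sub>C p)
      = (\<Sum>(a, b)\<in>Poly_Mapping.keys p. Poly_Mapping.lookup (c *\<^sub>C p) (a, b) *\<^sub>C f a b)"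
    by (intro free_lift_superset) (auto simp: in_keys_iff lookup_scaleC scaleC_complex_def)
  also have "\<dots> = c *\<^sub>C free_lift f p"
    by (simp add: free_lift_def lookup_scaleC scaleC_complex_def complex_vector.scale_sum_right
        scaleC_scaleC case_prod_unfold)
  finally show "free_lift f (c *\<^sub>C p) = c *\<^sub>C free_lift f p" .
qed

lemma clinear_diff: "clinear f \<Longrightarrow> f (x - y) = f x - f y"
  by (metis clinear_add diff_add_cancel add_diff_cancel_right')

lemma free_lift_single: "free_lift f (Poly_Mapping.single (a, b) 1) = f a b"
  by (simp add: free_lift_def scaleC_one)

lemma free_lift_relators:
  assumes "cbilinear f" "p \<in> cspan tensor_relators"
  shows "free_lift f p = 0"
  using assms(2)
proof (induction rule: complex_vector.span_induct)
  case base
  show "csubspace {x. free_lift f x = 0}"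
    by (rule complex_vector.subspaceI)
      (simp_all add: free_lift_def clinear_add[OF clinear_free_lift, unfolded free_lift_def]
        clinear_scale[OF clinear_free_lift, unfolded free_lift_def])
next
  case (step p)
  have *: "f (a + a') b = f a b + f a' b" "f a (b + b') = f a b + f a b'"
    "f (c *\<^sub>C a) b = c *\<^sub>C f a b" "f a (c *\<^sub>C b) = c *\<^sub>C f a b" for a a' b b' c
    using assms(1) by (auto simp: cbilinear_def clinear_add clinear_scale
        dest: clinear_add[of "\<lambda>a. f a b"] clinear_scale[of "\<lambda>a. f a b"])
  show ?case
    using step unfolding tensor_relators_def Let_def
    by (auto simp: clinear_diff[OF clinear_free_lift] clinear_scale[OF clinear_free_lift]
        free_lift_single *)
qed

lemma tensor_lift_abs:
  assumes "cbilinear f"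
  shows "tensor_lift f (abs_tensor p) = free_lift f p"
proof -
  have "tensor_equiv (rep_tensor (abs_tensor p)) p"
    by (metis Quotient3_tensor equivp_tensor_equiv rep_abs_rsp_left equivp_reflp)
  then have "free_lift f (rep_tensor (abs_tensor p) - p) = 0"
    using free_lift_relators[OF assms] by (simp add: tensor_equiv_def)
  then show ?thesis
    by (simp add: tensor_lift_def clinear_diff[OF clinear_free_lift])
qed

lemma tensor_lift_tensor: "cbilinear f \<Longrightarrow> tensor_lift f (a \<otimes>\<^sub>C b) = f a b"
  by (simp add: tensor.abs_eq tensor_lift_abs free_lift_single)

lemma clinear_tensor_lift:
  assumes "cbilinear f"
  shows "clinear (tensor_lift f)"
proof (rule clinearI)
  fix s t :: "('a, 'b) tensor" and c :: complex
  show "tensor_lift f (s + t) = tensor_lift f s + tensor_lift f t"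
    by (induction s; induction t)
      (simp add: plus_tensor.abs_eq tensor_lift_abs[OF assms] clinear_add[OF clinear_free_lift])
  show "tensor_lift f (c *\<^sub>C t) = c *\<^sub>C tensor_lift f t"
    by (induction t)
      (simp add: scaleC_tensor.abs_eq tensor_lift_abs[OF assms] clinear_scale[OF clinear_free_lift])
qed

lemma cbilinear_tensor: "cbilinear (\<otimes>\<^sub>C)"
proof -
  have "(a + a') \<otimes>\<^sub>C b = a \<otimes>\<^sub>C b + a' \<otimes>\<^sub>C b" "a \<otimes>\<^sub>C (b + b') = a \<otimes>\<^sub>C b + a \<otimes>\<^sub>C b'"
    "(c *\<^sub>C a) \<otimes>\<^sub>C b = c *\<^sub>C (a \<otimes>\<^sub>C b)" "a \<otimes>\<^sub>C (c *\<^sub>C b) = c *\<^sub>C (a \<otimes>\<^sub>C b)"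
    for a a' :: 'a and b b' :: 'b and c
    by (transfer, unfold tensor_equiv_def, rule complex_vector.span_base,
        unfold tensor_relators_def Let_def diff_diff_eq[symmetric], blast)+
  then show ?thesis
    unfolding cbilinear_def by (auto intro!: clinearI)
qed

definition tensor_map :: "('a::complex_vector \<Rightarrow> 'c::complex_vector) \<Rightarrow>
    ('b::complex_vector \<Rightarrow> 'd::complex_vector) \<Rightarrow> ('a, 'b) tensor \<Rightarrow> ('c, 'd) tensor"
  where "tensor_map f g = tensor_lift (\<lambda>a b. f a \<otimes>\<^sub>C g b)"

definition tensor_assoc :: "(('a::complex_vector, 'b::complex_vector) tensor, 'c::complex_vector) tensor
    \<Rightarrow> ('a, ('b, 'c) tensor) tensor"
  where "tensor_assoc = tensor_lift (\<lambda>t c. tensor_lift (\<lambda>a b. a \<otimes>\<^sub>C (b \<otimes>\<^sub>C c)) t)"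

definition tensor_mult :: "('a::complex_algebra_1, 'b::complex_algebra_1) tensor
    \<Rightarrow> ('a, 'b) tensor \<Rightarrow> ('a, 'b) tensor"
  where "tensor_mult s t =
    tensor_lift (\<lambda>a b. tensor_lift (\<lambda>a' b'. (a * a') \<otimes>\<^sub>C (b * b')) t) s"

locale hopf_algebra =
  fixes comult :: "'h::complex_algebra_1 \<Rightarrow> ('h, 'h) tensor"
    and counit :: "'h \<Rightarrow> complex"
    and antipode :: "'h \<Rightarrow> 'h"
  assumes comult_linear: "clinear comult"
    and counit_linear: "clinear counit"
    and antipode_linear: "clinear antipode"
    and coassoc: "tensor_assoc (tensor_map comult id (comult h)) = tensor_map id comult (comult h)"
    and counit_left: "tensor_lift (\<lambda>a b. counit a *\<^sub>C b) (comult h) = h"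
    and counit_right: "tensor_lift (\<lambda>a b. counit b *\<^sub>C a) (comult h) = h"
    and comult_one: "comult 1 = 1 \<otimes>\<^sub>C 1"
    and comult_mult: "comult (a * b) = tensor_mult (comult a) (comult b)"
    and counit_one: "counit 1 = 1"
    and counit_mult: "counit (a * b) = counit a * counit b"
    and antipode_left: "tensor_lift (\<lambda>a b. antipode a * b) (comult h) = counit h *\<^sub>C 1"
    and antipode_right: "tensor_lift (\<lambda>a b. a * antipode b) (comult h) = counit h *\<^sub>C 1"
begin

definition hopf_ideal :: "'h set \<Rightarrow> bool"
  where "hopf_ideal I \<longleftrightarrow>
    csubspace I \<and> (\<forall>x\<in>I. \<forall>a. a * x \<in> I \<and> x * a \<in> I) \<and>
    (\<forall>x\<in>I. comult x \<in>
      {s + t | s t. s \<in> cspan {a \<otimes>\<^sub>C y | a y. y \<in> I} \<and> t \<in> cspan {y \<otimes>\<^sub>C a | a y. y \<in> I}}) \<and>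
    (\<forall>x\<in>I. counit x = 0) \<and> (\<forall>x\<in>I. antipode x \<in> I)"

end

definition finite_dimensional :: "'a::complex_vector itself \<Rightarrow> bool"
  where "finite_dimensional _ \<longleftrightarrow> (\<exists>B::'a set. finite B \<and> cspan B = UNIV)"

text \<open>The group algebra of \<open>G\<close> is the space of finitely supported functions on \<open>carrier G\<close>;
  \<open>Poly_Mapping.single g 1\<close> is the basis element of \<open>g\<close>. The multiplication that
  \<open>Poly_Mapping\<close> puts on its type belongs to an additive monoid structure on the index
  type and is not used here.\<close>

definition ga_carrier :: "('g, 'm) monoid_scheme \<Rightarrow> ('g \<Rightarrow>\<^sub>0 complex) set"
  where "ga_carrier G = {p. Poly_Mapping.keys p \<subseteq> carrier G}"

definition ga_one :: "('g, 'm) monoid_scheme \<Rightarrow> 'g \<Rightarrow>\<^sub>0 complex"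
  where "ga_one G = Poly_Mapping.single \<one>\<^bsub>G\<^esub> 1"

definition ga_mult :: "('g, 'm) monoid_scheme \<Rightarrow> ('g \<Rightarrow>\<^sub>0 complex) \<Rightarrow> ('g \<Rightarrow>\<^sub>0 complex) \<Rightarrow> 'g \<Rightarrow>\<^sub>0 complex"
  where "ga_mult G p q = (\<Sum>x\<in>Poly_Mapping.keys p. \<Sum>y\<in>Poly_Mapping.keys q.
    Poly_Mapping.single (x \<otimes>\<^bsub>G\<^esub> y) (Poly_Mapping.lookup p x * Poly_Mapping.lookup q y))"

definition ga_comult :: "('g \<Rightarrow>\<^sub>0 complex) \<Rightarrow> ('g \<Rightarrow>\<^sub>0 complex, 'g \<Rightarrow>\<^sub>0 complex) tensor"
  where "ga_comult p = (\<Sum>x\<in>Poly_Mapping.keys p.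
    Poly_Mapping.lookup p x *\<^sub>C (Poly_Mapping.single x 1 \<otimes>\<^sub>C Poly_Mapping.single x 1))"

definition ga_counit :: "('g \<Rightarrow>\<^sub>0 complex) \<Rightarrow> complex"
  where "ga_counit p = (\<Sum>x\<in>Poly_Mapping.keys p. Poly_Mapping.lookup p x)"

definition ga_antipode :: "('g, 'm) monoid_scheme \<Rightarrow> ('g \<Rightarrow>\<^sub>0 complex) \<Rightarrow> 'g \<Rightarrow>\<^sub>0 complex"
  where "ga_antipode G p = (\<Sum>x\<in>Poly_Mapping.keys p.
    Poly_Mapping.single (inv\<^bsub>G\<^esub> x) (Poly_Mapping.lookup p x))"

definition (in hopf_algebra) group_algebra_iso ::
  "('g, 'm) monoid_scheme \<Rightarrow> ('h \<Rightarrow> ('g \<Rightarrow>\<^sub>0 complex)) \<Rightarrow> bool"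
  where "group_algebra_iso G \<phi> \<longleftrightarrow>
    clinear \<phi> \<and> bij_betw \<phi> UNIV (ga_carrier G) \<and>
    \<phi> 1 = ga_one G \<and> (\<forall>a b. \<phi> (a * b) = ga_mult G (\<phi> a) (\<phi> b)) \<and>
    (\<forall>a. tensor_map \<phi> \<phi> (comult a) = ga_comult (\<phi> a)) \<and>
    (\<forall>a. counit a = ga_counit (\<phi> a)) \<and>
    (\<forall>a. \<phi> (antipode a) = ga_antipode G (\<phi> a))"

text \<open>The group is sought on a subset of the type \<open>'h\<close>, which is no restriction: an isomorphism
  with the group algebra of \<open>G\<close> embeds \<open>G\<close> into the algebra.\<close>

definition (in hopf_algebra) is_group_algebra :: bool
  where "is_group_algebra \<longleftrightarrow> (\<exists>(G :: 'h monoid) \<phi>. group G \<and> group_algebra_iso G \<phi>)"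

text \<open>A formal series in \<open>z0, z1, z2\<close> is the function sending \<open>(a, b, c)\<close> to its coefficient
  at \<open>z0^a z1^b z2^c\<close>.\<close>

type_synonym 'a series3 = "int \<times> int \<times> int \<Rightarrow> 'a"

text \<open>Coefficient at \<open>x^i y^j\<close> of \<open>(x - y)^n\<close>, expanded in nonnegative powers of \<open>y\<close>.\<close>

definition binom_coeff :: "int \<Rightarrow> int \<Rightarrow> int \<Rightarrow> complex"
  where "binom_coeff n i j =
    (if 0 \<le> j \<and> i + j = n then (- 1) ^ nat j * (of_int n gchoose nat j) else 0)"

text \<open>In \<open>z0^(-1) \<delta>((z1 - z2)/z0) = \<Sum>n. z0^(-n-1) (z1 - z2)^n\<close> only \<open>n = -a-1\<close> contributes to
  \<open>z0^a\<close>; similarly for \<open>z0^(-1) \<delta>((z2 - z1)/(-z0))\<close> and \<open>z2^(-1) \<delta>((z1 - z0)/z2)\<close>.\<close>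

definition delta_z1_z2 :: "complex series3"
  where "delta_z1_z2 = (\<lambda>(a, b, c). binom_coeff (- a - 1) b c)"

definition delta_z2_z1 :: "complex series3"
  where "delta_z2_z1 = (\<lambda>(a, b, c). (- 1) powi (- a - 1) * binom_coeff (- a - 1) c b)"

definition delta_z1_z0 :: "complex series3"
  where "delta_z1_z0 = (\<lambda>(a, b, c). binom_coeff (- c - 1) b a)"

text \<open>The products in the Jacobi identity are only formed where, by truncation, each coefficient
  is a finite sum; \<open>Sum_any\<close> sums over the finite support.\<close>

definition series3_mult :: "complex series3 \<Rightarrow> 'v::complex_vector series3 \<Rightarrow> 'v series3"
  where "series3_mult d f = (\<lambda>(a, b, c).
    Sum_any (\<lambda>(i, j, k). d (i, j, k) *\<^sub>C f (a - i, b - j, c - k)))"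

text \<open>\<open>Y u n v\<close> is \<open>u_n v\<close>, the coefficient of \<open>Y(u,z)v\<close> at \<open>z^(-n-1)\<close>. The three series
  \<open>Y(u,z1)Y(v,z2)w\<close>, \<open>Y(v,z2)Y(u,z1)w\<close>, \<open>Y(Y(u,z0)v,z2)w\<close> do not involve one of the variables.\<close>

locale vertex_algebra =
  fixes vac :: "'v::complex_vector"
    and Y :: "'v \<Rightarrow> int \<Rightarrow> 'v \<Rightarrow> 'v"
  assumes Y_bilinear: "cbilinear (\<lambda>u v. Y u n v)"
    and truncation: "\<exists>N. \<forall>n\<ge>N. Y u n v = 0"
    and vacuum: "Y vac n v = (if n = - 1 then v else 0)"
    and creation: "Y u (- 1) vac = u" "n \<ge> 0 \<Longrightarrow> Y u n vac = 0"
    and jacobi: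
      "series3_mult delta_z1_z2 (\<lambda>(a, b, c). if a = 0 then Y u (- b - 1) (Y v (- c - 1) w) else 0) p
       - series3_mult delta_z2_z1 (\<lambda>(a, b, c). if a = 0 then Y v (- c - 1) (Y u (- b - 1) w) else 0) p
       = series3_mult delta_z1_z0 (\<lambda>(a, b, c). if b = 0 then Y (Y u (- a - 1) v) (- c - 1) w else 0) p"
begin

text \<open>\<open>pi2 t k\<close> is the coefficient of \<open>\<pi>\<^sub>2 t\<close> at \<open>z^k\<close>; by truncation \<open>pi2 t\<close> is a Laurent series.\<close>

definition pi2 :: "('v, 'v) tensor \<Rightarrow> int \<Rightarrow> 'v"
  where "pi2 t = (\<lambda>k. tensor_lift (\<lambda>u v. Y u (- k - 1) v) t)"

definition pi2_injective :: bool
  where "pi2_injective \<longleftrightarrow> inj pi2"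

end

locale module_vertex_algebra = hopf_algebra comult counit antipode + vertex_algebra vac Y
  for comult :: "'h::complex_algebra_1 \<Rightarrow> ('h, 'h) tensor"
    and counit :: "'h \<Rightarrow> complex"
    and antipode :: "'h \<Rightarrow> 'h"
    and vac :: "'v::complex_vector"
    and Y :: "'v \<Rightarrow> int \<Rightarrow> 'v \<Rightarrow> 'v" +
  fixes act :: "'h \<Rightarrow> 'v \<Rightarrow> 'v"
  assumes act_bilinear: "cbilinear act"
    and act_one: "act 1 v = v"
    and act_mult: "act (a * b) v = act a (act b v)"
    and act_vac: "act h vac = counit h *\<^sub>C vac"
    and act_Y: "act h (Y u n v) = tensor_lift (\<lambda>a b. Y (act a u) n (act b v)) (comult h)"
begin

definition inner_faithful :: bool
  where "inner_faithful \<longleftrightarrow> (\<forall>I. hopf_ideal I \<and> I \<noteq> {0} \<longrightarrow> (\<exists>h\<in>I. \<exists>v. act h v \<noteq> 0))"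

end

end

theory Submission
  imports Defs "HOL-Computational_Algebra.Fundamental_Theorem_Algebra"
begin

text \<open>Since \<open>\<pi>\<^sub>2\<close> is injective, the annihilator \<open>K\<close> of \<open>V\<close> in \<open>H\<close> also annihilates
  \<open>V \<otimes> V\<close>, so it is a biideal, and by finite dimension a Hopf ideal; inner faithfulness gives
  \<open>K = 0\<close>. Skew symmetry \<open>Y(u,z)v = e\<^sup>z\<^sup>D Y(v,-z)u\<close>, in which \<open>D\<close> commutes with \<open>H\<close>, shows
  that \<open>\<Sum> h1 u \<otimes> h2 v = \<Sum> h2 u \<otimes> h1 v\<close>, so \<open>H\<close> is cocommutative. A finite-dimensional
  cocommutative Hopf algebra over \<open>\<complex>\<close> has no nonzero primitive elements; as the
  contractions \<open>h \<mapsto> \<Sum> f(h1) h2\<close> commute, a common eigenvector modulo the span of the grouplikes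
  would yield skew-primitive elements outside this span, so the grouplikes form a basis.\<close>

section \<open>Linear maps and tensors\<close>

text \<open>\<open>pi2\<close> intertwines the actions of \<open>H\<close> because of
  \<open>act_Y\<close>, so an \<open>h\<close> that kills \<open>V\<close> also kills, through
  \<open>comult h\<close>, every \<open>u \<otimes> v\<close>; linear algebra over a field then puts
  \<open>comult h\<close> into \<open>H \<otimes> K + K \<otimes> H\<close>. The counit vanishes on
  \<open>K\<close> because \<open>h\<close> acts on the vacuum as the scalar
  \<open>counit h\<close>, an argument that requires a nonzero vacuum and forces a separate
  treatment of \<open>V = 0\<close>. In the second half, contraction is the action of the dual
  algebra on \<open>H\<close>. Cocommutativity makes the dual algebra commutative, and a common
  eigenvector modulo a subcoalgebra has as eigenvalues the values of a character
  \<open>f \<mapsto> f g\<close>, whose \<open>g\<close> is grouplike. The complex numbers enter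
  twice: algebraic closedness provides eigenvectors, and characteristic 0 excludes primitive
  elements, since differentiating a minimal polynomial lowers its degree without killing its leading
  term.\<close>

lemma clinear_compose: "clinear f \<Longrightarrow> clinear g \<Longrightarrow> clinear (\<lambda>x. f (g x))"
  by (intro clinearI) (simp_all add: clinear_add clinear_scale)

lemma clinear_ident: "clinear (\<lambda>x. x)"
  by (intro clinearI) simp_all

lemma clinear_zero: "clinear f \<Longrightarrow> f 0 = 0"
  by (metis clinear_diff diff_self)

lemma clinear_sum: "clinear f \<Longrightarrow> f (sum g A) = (\<Sum>a\<in>A. f (g a))"
  by (induction A rule: infinite_finite_induct) (simp_all add: clinear_zero clinear_add)

lemma clinear_plus: "clinear f \<Longrightarrow> clinear g \<Longrightarrow> clinear (\<lambda>x. f x + g x)"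
  by (intro clinearI) (simp_all add: clinear_add clinear_scale scaleC_add_right algebra_simps)

lemma clinear_scaled: "clinear f \<Longrightarrow> clinear (\<lambda>x. c *\<^sub>C f x)"
  by (intro clinearI) (simp_all add: clinear_add clinear_scale scaleC_add_right scaleC_scaleC mult.commute)

lemma clinear_const_zero: "clinear (\<lambda>x. 0)"
  by (intro clinearI) simp_all

lemma clinear_minus: "clinear f \<Longrightarrow> clinear g \<Longrightarrow> clinear (\<lambda>x. f x - g x)"
  by (intro clinearI)
    (simp_all add: clinear_add clinear_scale complex_vector.scale_right_diff_distrib)

lemma clinear_sum_fun: "(\<And>i. i \<in> A \<Longrightarrow> clinear (f i)) \<Longrightarrow> clinear (\<lambda>x. \<Sum>i\<in>A. f i x)"
  by (induction A rule: infinite_finite_induct) (simp_all add: clinear_const_zero clinear_plus)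

lemma cbilinearI: "(\<And>a. clinear (f a)) \<Longrightarrow> (\<And>b. clinear (\<lambda>a. f a b)) \<Longrightarrow> cbilinear f"
  by (simp add: cbilinear_def)

lemma cbilinear_right: "cbilinear f \<Longrightarrow> clinear g \<Longrightarrow> clinear (\<lambda>x. f a (g x))"
  unfolding cbilinear_def using clinear_compose[of "\<lambda>x. f a x" g] by auto

lemma cbilinear_left: "cbilinear f \<Longrightarrow> clinear g \<Longrightarrow> clinear (\<lambda>x. f (g x) b)"
  unfolding cbilinear_def using clinear_compose[of "\<lambda>x. f x b" g] by auto

lemma cbilinear_scaleC: "cbilinear (*\<^sub>C)"
  by (intro cbilinearI clinearI)
    (simp_all add: scaleC_add_right scaleC_add_left scaleC_scaleC scaleC_complex_def mult.commute)

lemma cbilinear_mult: "cbilinear ((*) :: 'a::complex_algebra_1 \<Rightarrow> _)"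
  by (intro cbilinearI clinearI)
    (simp_all add: algebra_simps mult_scaleC_left mult_scaleC_right)

lemma clinear_tensor_lift': "cbilinear f \<Longrightarrow> clinear g \<Longrightarrow> clinear (\<lambda>x. tensor_lift f (g x))"
  by (rule clinear_compose[OF clinear_tensor_lift])

text \<open>\<open>tensor_lift\<close> is a finite sum over one fixed representative of
  \<open>t\<close>, so a linear map passes through it term by term.\<close>

lemma tensor_lift_apply:
  "clinear F \<Longrightarrow> F (tensor_lift f t) = tensor_lift (\<lambda>a b. F (f a b)) t"
  by (simp add: tensor_lift_def free_lift_def clinear_sum clinear_scale case_prod_unfold)

lemma clinear_tensor_lift_fun:
  "(\<And>a b. clinear (\<lambda>x. F x a b)) \<Longrightarrow> clinear (\<lambda>x. tensor_lift (F x) t)"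
  unfolding tensor_lift_def free_lift_def
  by (intro clinear_sum_fun) (auto intro!: clinear_scaled)

text \<open>Each rule reduces linearity of a composite expression to that of its parts, so
  \<open>intro\<close> handles nested Sweedler sums.\<close>

lemmas clin = clinear_ident clinear_plus clinear_scaled clinear_minus
  cbilinear_left[OF cbilinear_scaleC]
  cbilinear_left[OF cbilinear_mult] cbilinear_right[OF cbilinear_mult]
  cbilinear_left[OF cbilinear_tensor] cbilinear_right[OF cbilinear_tensor]
  clinear_tensor_lift' clinear_tensor_lift_fun cbilinearI

lemma tensor_add_left: "(a + a') \<otimes>\<^sub>C b = a \<otimes>\<^sub>C b + a' \<otimes>\<^sub>C b"
  and tensor_add_right: "a \<otimes>\<^sub>C (b + b') = a \<otimes>\<^sub>C b + a \<otimes>\<^sub>C b'"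
  and tensor_scale_left: "(c *\<^sub>C a) \<otimes>\<^sub>C b = c *\<^sub>C (a \<otimes>\<^sub>C b)"
  and tensor_scale_right: "a \<otimes>\<^sub>C (c *\<^sub>C b) = c *\<^sub>C (a \<otimes>\<^sub>C b)"
  and tensor_zero_left: "0 \<otimes>\<^sub>C b = 0"
  and tensor_zero_right: "a \<otimes>\<^sub>C 0 = 0"
  using cbilinear_tensor unfolding cbilinear_def
  by (auto dest: clinear_add clinear_scale clinear_zero
      clinear_add[of "\<lambda>a. a \<otimes>\<^sub>C b"] clinear_scale[of "\<lambda>a. a \<otimes>\<^sub>C b"] clinear_zero[of "\<lambda>a. a \<otimes>\<^sub>C b"])

text \<open>For \<open>t = comult h\<close> this is the Sweedler form of the comultiplication. It
  also reduces statements about tensors to pure ones in \<open>tensor_induct\<close>.\<close>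

lemma tensor_lift_tensor_eq: "tensor_lift (\<otimes>\<^sub>C) t = t"
proof (induction t)
  case (1 p)
  let ?A = "\<lambda>p. abs_tensor p :: ('a, 'b) tensor"
  have lin: "clinear ?A"
    by (intro clinearI) (simp_all add: plus_tensor.abs_eq scaleC_tensor.abs_eq)
  have "p = free_lift (\<lambda>a b. Poly_Mapping.single (a, b) 1) p"
    unfolding free_lift_def
    by (rule poly_mapping_eqI)
      (simp add: lookup_sum lookup_scaleC lookup_single case_prod_unfold scaleC_complex_def
        when_def if_distrib sum.delta' in_keys_iff cong: if_cong)
  then have "?A p = ?A (free_lift (\<lambda>a b. Poly_Mapping.single (a, b) 1) p)"
    by simp
  also have "\<dots> = free_lift (\<otimes>\<^sub>C) p"
    by (simp add: free_lift_def clinear_sum[OF lin] clinear_scale[OF lin] tensor.abs_eq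
        case_prod_unfold)
  also have "\<dots> = tensor_lift (\<otimes>\<^sub>C) (?A p)"
    by (simp only: tensor_lift_abs[OF cbilinear_tensor])
  finally show ?case by (rule sym)
qed

lemma tensor_induct [case_names pure add]:
  assumes pure: "\<And>a b. P (a \<otimes>\<^sub>C b)" and add: "\<And>s t. P s \<Longrightarrow> P t \<Longrightarrow> P (s + t)"
  shows "P t"
proof -
  have "P 0"
    using pure[of 0 0] by (simp add: tensor_zero_left)
  have "P (\<Sum>(a, b)\<in>A. c (a, b) *\<^sub>C (a \<otimes>\<^sub>C b))" for A c
    by (induction A rule: infinite_finite_induct)
      (auto intro!: add \<open>P 0\<close> pure simp: tensor_scale_left[symmetric])
  from this[where c = "Poly_Mapping.lookup (rep_tensor t)"]
  have "P (tensor_lift (\<otimes>\<^sub>C) t)"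
    unfolding tensor_lift_def free_lift_def .
  then show ?thesis by (simp add: tensor_lift_tensor_eq)
qed

lemma tensor_linear_eqI:
  assumes "clinear F" "clinear G" "\<And>a b. F (a \<otimes>\<^sub>C b) = G (a \<otimes>\<^sub>C b)"
  shows "F t = G t"
  by (induction t rule: tensor_induct) (simp_all add: assms clinear_add)

lemma tensor_map_tensor:
  assumes "clinear f" "clinear g"
  shows "tensor_map f g (a \<otimes>\<^sub>C b) = f a \<otimes>\<^sub>C g b"
    and "clinear (tensor_map f g)"
proof -
  have "cbilinear (\<lambda>a b. f a \<otimes>\<^sub>C g b)"
    by (intro clin assms)
  then show "tensor_map f g (a \<otimes>\<^sub>C b) = f a \<otimes>\<^sub>C g b" "clinear (tensor_map f g)"
    by (simp_all add: tensor_map_def tensor_lift_tensor clinear_tensor_lift)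
qed

section \<open>Functionals, bases and finite dimension\<close>

lemma clinear_representation:
  "complex_vector.independent B \<Longrightarrow> cspan B = UNIV \<Longrightarrow>
    clinear (\<lambda>x. complex_vector.representation B x b)"
  by (intro clinearI)
    (simp_all add: complex_vector.representation_add complex_vector.representation_scale
      scaleC_complex_def)

text \<open>The functional is the coordinate at \<open>x\<close> for a basis of the whole space that
  extends \<open>x\<close> together with a basis of the span of \<open>S\<close>.\<close>

lemma separating_functional:
  assumes "x \<notin> cspan S"
  obtains f where "clinear f" "f x = (1::complex)" "\<And>y. y \<in> cspan S \<Longrightarrow> f y = 0"
proof -
  obtain B where B: "B \<subseteq> S" "complex_vector.independent B" "S \<subseteq> cspan B"
    by (rule complex_vector.maximal_independent_subset[of S])
  have sub: "cspan S \<subseteq> cspan B"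
    using B(3) by (metis complex_vector.span_mono complex_vector.span_span)
  have "x \<notin> cspan B"
    using assms B(1) complex_vector.span_mono by blast
  then have "complex_vector.independent (insert x B)"
    using B(2) complex_vector.independent_insertI by blast
  then obtain E where E: "insert x B \<subseteq> E" "complex_vector.independent E" "cspan E = UNIV"
    by (metis complex_vector.maximal_independent_subset_extend[of "insert x B" UNIV] subset_UNIV top.extremum_uniqueI)
  let ?f = "\<lambda>y. complex_vector.representation E y x"
  have lin: "clinear ?f"
    by (rule clinear_representation[OF E(2,3)])
  show thesis
  proof (rule that[OF lin])
    show "?f x = 1"
      using E by (simp add: complex_vector.representation_basis)
    fix y assume "y \<in> cspan S"
    then have "y \<in> cspan B" using sub by auto
    then show "?f y = 0"
    proof (induction rule: complex_vector.span_induct_alt)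
      case base
      then show ?case by (simp add: complex_vector.representation_zero)
    next
      case (step c b z)
      have "b \<noteq> x" "b \<in> E"
        using step(1) \<open>x \<notin> cspan B\<close> E(1) complex_vector.span_base by auto
      then have "?f b = 0"
        using E by (simp add: complex_vector.representation_basis)
      then show ?case
        using step(2) by (simp add: clinear_add[OF lin] clinear_scale[OF lin])
    qed
  qed
qed

lemma functional_eqI:
  assumes "\<And>f. clinear f \<Longrightarrow> f x = (f y :: complex)"
  shows "x = y"
proof (rule ccontr)
  assume "x \<noteq> y"
  then have "x - y \<notin> cspan {}" by simp
  then obtain f where f: "clinear f" "f (x - y) = (1::complex)"
    by (rule separating_functional)
  then show False using assms[OF f(1)] by (simp add: clinear_diff)
qed

lemma finite_dimensional_basis:
  assumes "finite_dimensional TYPE('a::complex_vector)"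
  obtains B :: "'a::complex_vector set" where "finite B" "complex_vector.independent B" "cspan B = UNIV"
proof -
  obtain S :: "'a set" where S: "finite S" "cspan S = UNIV"
    using assms by (auto simp: finite_dimensional_def)
  obtain B where B: "B \<subseteq> S" "complex_vector.independent B" "S \<subseteq> cspan B"
    by (rule complex_vector.maximal_independent_subset[of S])
  have "cspan B = UNIV"
    using S(2) B(3) by (metis complex_vector.span_mono complex_vector.span_span top.extremum_uniqueI)
  with B S that show thesis by (metis finite_subset)
qed

text \<open>The partner of \<open>e\<close> is found by evaluating the coordinate functional of
  \<open>e\<close> on the second factor, so it depends linearly on \<open>t\<close>.\<close>

lemma tensor_basis_expansion:
  assumes "finite B" "complex_vector.independent B" "cspan B = UNIV"
  shows "t = (\<Sum>e\<in>B. tensor_lift (\<lambda>a b. complex_vector.representation B b e *\<^sub>C a) t \<otimes>\<^sub>C e)"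
    (is "_ = ?R t")
proof -
  note rep = clinear_representation[OF assms(2,3)]
  have bil: "cbilinear (\<lambda>a b. complex_vector.representation B b e *\<^sub>C a)" for e
    by (intro clin rep)
  have "a \<otimes>\<^sub>C b = ?R (a \<otimes>\<^sub>C b)" for a :: 'b and b
  proof -
    have "a \<otimes>\<^sub>C b = a \<otimes>\<^sub>C (\<Sum>e\<in>B. complex_vector.representation B b e *\<^sub>C e)"
      using complex_vector.sum_representation_eq[of B b B] assms by simp
    also have "\<dots> = (\<Sum>e\<in>B. a \<otimes>\<^sub>C complex_vector.representation B b e *\<^sub>C e)"
      by (rule clinear_sum) (intro clin)
    also have "\<dots> = ?R (a \<otimes>\<^sub>C b)"
      by (simp add: tensor_lift_tensor[OF bil] tensor_scale_left tensor_scale_right)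
    finally show ?thesis .
  qed
  then show ?thesis
    by (intro tensor_linear_eqI[where t = t and F = "\<lambda>t. t" and G = ?R])
      (intro clin clinear_sum_fun bil rep)+
qed

lemma finite_dimensional_tensor:
  assumes "finite_dimensional TYPE('a::complex_vector)" "finite_dimensional TYPE('b::complex_vector)"
  shows "finite_dimensional TYPE(('a, 'b) tensor)"
proof -
  obtain A :: "'a set" where A: "finite A" "cspan A = UNIV"
    using assms(1) by (auto simp: finite_dimensional_def)
  obtain B :: "'b set" where B: "finite B" "cspan B = UNIV"
    using assms(2) by (auto simp: finite_dimensional_def)
  let ?S = "(\<lambda>(a, b). a \<otimes>\<^sub>C b) ` (A \<times> B)"
  have *: "a \<otimes>\<^sub>C b \<in> cspan ?S" if "b \<in> B" for a b
  proof -
    have "a \<in> cspan A" using A by simp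
    then show ?thesis
    proof (induction rule: complex_vector.span_induct_alt)
      case base
      show ?case by (simp add: tensor_zero_left complex_vector.span_zero)
    next
      case (step c x y)
      then have "x \<otimes>\<^sub>C b \<in> cspan ?S"
        using that by (intro complex_vector.span_base) auto
      with step show ?case
        by (simp add: tensor_add_left tensor_scale_left complex_vector.span_add
            complex_vector.span_scale)
    qed
  qed
  have "a \<otimes>\<^sub>C b \<in> cspan ?S" for a b
  proof -
    have "b \<in> cspan B" using B by simp
    then show ?thesis
      by (induction rule: complex_vector.span_induct_alt)
        (auto simp: tensor_zero_right tensor_add_right tensor_scale_right
          intro!: * complex_vector.span_zero complex_vector.span_add complex_vector.span_scale)
  qed
  then have "t \<in> cspan ?S" for t
    by (induction t rule: tensor_induct) (auto intro: complex_vector.span_add)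
  then show ?thesis
    using A B unfolding finite_dimensional_def by (intro exI[of _ ?S]) auto
qed

section \<open>Biideals of finite-dimensional Hopf algebras\<close>

definition tensor_ideal :: "'a::complex_vector set \<Rightarrow> ('a, 'a) tensor set"
  where "tensor_ideal K = cspan ({a \<otimes>\<^sub>C y | a y. y \<in> K} \<union> {y \<otimes>\<^sub>C a | a y. y \<in> K})"

lemma clinear_span_into:
  assumes "t \<in> cspan S" "clinear F" "csubspace U" "\<And>x. x \<in> S \<Longrightarrow> F x \<in> U"
  shows "F t \<in> U"
  using assms(1)
proof (induction rule: complex_vector.span_induct_alt)
  case base
  show ?case using assms by (simp add: clinear_zero complex_vector.subspace_0)
next
  case (step c x y)
  then show ?case using assms
    by (simp add: clinear_add clinear_scale complex_vector.subspace_add complex_vector.subspace_scale)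
qed

lemma clinear_inj_subspace_onto:
  assumes "finite_dimensional TYPE('a::complex_vector)"
    and "clinear (T :: 'a \<Rightarrow> 'a)" "inj T" "csubspace U" "T ` U \<subseteq> U"
  shows "T ` U = U"
proof -
  obtain B :: "'a set" where B: "finite B" "complex_vector.independent B" "cspan B = UNIV"
    by (rule finite_dimensional_basis[OF assms(1)])
  interpret fd: finite_dimensional_vector_space_pair_1 "scaleC :: _ \<Rightarrow> 'a \<Rightarrow> 'a" B "scaleC :: _ \<Rightarrow> 'a \<Rightarrow> 'a"
    using B by unfold_locales
  have "complex_vector.dim (T ` U) = complex_vector.dim U"
    using assms by (intro fd.dim_image_eq) (auto intro: inj_on_subset)
  moreover have "csubspace (T ` U)"
    using assms by (intro fd.linear_subspace_image)
  ultimately show ?thesis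
    using assms by (intro fd.vs1.subspace_dim_equal) auto
qed

text \<open>Take a basis \<open>B\<close> extending a basis \<open>A\<close> of the kernel and write
  \<open>t\<close> as the sum of \<open>c e \<otimes>\<^sub>C e\<close>. Terms with \<open>e\<close>
  in \<open>A\<close> are in the ideal by their second factor; for the others \<open>c e\<close> is
  shown to act as zero.\<close>

lemma tensor_ideal_kernelI:
  assumes fin: "finite_dimensional TYPE('h::complex_vector)"
    and act: "cbilinear (act :: 'h \<Rightarrow> 'm::complex_vector \<Rightarrow> 'n::complex_vector)"
    and zero: "\<And>u v. tensor_lift (\<lambda>a b. act a u \<otimes>\<^sub>C act b v) t = 0"
  shows "t \<in> tensor_ideal {h. \<forall>v. act h v = 0}"
proof -
  let ?K = "{h. \<forall>v. act h v = 0}"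
  note act_lin = cbilinear_left[OF act]
  have sub: "csubspace ?K"
    using clinear_add[OF act_lin[OF clinear_ident]] clinear_scale[OF act_lin[OF clinear_ident]]
      clinear_zero[OF act_lin[OF clinear_ident]]
    by (intro complex_vector.subspaceI) auto
  obtain A where A: "A \<subseteq> ?K" "complex_vector.independent A" "?K \<subseteq> cspan A"
    by (rule complex_vector.maximal_independent_subset[of ?K])
  obtain B where B: "A \<subseteq> B" "complex_vector.independent B" "cspan B = UNIV"
    by (metis complex_vector.maximal_independent_subset_extend[of A UNIV] A(2) subset_UNIV top.extremum_uniqueI)
  obtain S :: "'h set" where S: "finite S" "cspan S = UNIV"
    using fin by (auto simp: finite_dimensional_def)
  have finB: "finite B"
    using complex_vector.independent_span_bound[OF S(1) B(2)] S(2) by auto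
  note rep = clinear_representation[OF B(2,3)]
  define c where "c e = tensor_lift (\<lambda>a b. complex_vector.representation B b e *\<^sub>C a) t" for e
  have t: "t = (\<Sum>e\<in>B. c e \<otimes>\<^sub>C e)"
    unfolding c_def by (rule tensor_basis_expansion[OF finB B(2,3)])
  have repK: "complex_vector.representation B x e = 0" if "x \<in> ?K" "e \<notin> A" for x e
  proof -
    have "x \<in> cspan A" using that(1) A(3) by blast
    then show ?thesis
      using complex_vector.representation_extend[OF B(2) _ B(1), of x]
        complex_vector.representation_ne_zero[of A x e] that(2) by metis
  qed
  have "c e \<in> ?K" if e: "e \<in> B" "e \<notin> A" for e
  proof -
    have "act (c e) u = 0" for u
    proof (rule functional_eqI)
      fix f :: "'n \<Rightarrow> complex" assume f: "clinear f"
      \<comment> \<open>Applying \<open>f\<close> to the first factor of the vanishing tensor shows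
        that this combination annihilates every \<open>v\<close>. Its coordinate at an
        \<open>e\<close> outside \<open>A\<close> is \<open>f (act (c e) u)\<close>, which is
        therefore 0.\<close>
      have "(\<Sum>e\<in>B. f (act (c e) u) *\<^sub>C e) \<in> ?K"
      proof clarify
        fix v
        have bil: "cbilinear (\<lambda>x y. f x *\<^sub>C y)"
          by (intro clin f)
        have bil2: "cbilinear (\<lambda>a b. act a u \<otimes>\<^sub>C act b v)"
          by (intro clin act_lin)
        have "0 = tensor_lift (\<lambda>x y. f x *\<^sub>C y) (tensor_lift (\<lambda>a b. act a u \<otimes>\<^sub>C act b v) t)"
          by (simp add: zero clinear_zero[OF clinear_tensor_lift[OF bil]])
        also have "\<dots> = (\<Sum>e\<in>B. f (act (c e) u) *\<^sub>C act e v)"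
          by (subst t) (simp add: clinear_sum[OF clinear_tensor_lift[OF bil2]]
              clinear_sum[OF clinear_tensor_lift[OF bil]] tensor_lift_tensor[OF bil2]
              tensor_lift_tensor[OF bil])
        also have "\<dots> = act (\<Sum>e\<in>B. f (act (c e) u) *\<^sub>C e) v"
          using clinear_scale[OF act_lin[OF clinear_ident]]
          by (simp add: clinear_sum[OF act_lin[OF clinear_ident]])
        finally show "act (\<Sum>e\<in>B. f (act (c e) u) *\<^sub>C e) v = 0" by simp
      qed
      from repK[OF this e(2)]
      have "(\<Sum>e'\<in>B. f (act (c e') u) * complex_vector.representation B e' e) = 0"
        by (simp add: clinear_sum[OF rep] clinear_scale[OF rep] scaleC_complex_def)
      moreover have "(\<Sum>e'\<in>B. f (act (c e') u) * complex_vector.representation B e' e) =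
          (\<Sum>e'\<in>B. if e' = e then f (act (c e') u) else 0)"
        using B by (intro sum.cong) (auto simp: complex_vector.representation_basis)
      ultimately show "f (act (c e) u) = f 0"
        using e finB by (simp add: clinear_zero[OF f])
    qed
    then show ?thesis by simp
  qed
  then have "c e \<otimes>\<^sub>C e \<in> tensor_ideal ?K" if "e \<in> B" for e
    using that A(1) unfolding tensor_ideal_def
    by (cases "e \<in> A") (intro complex_vector.span_base; blast)+
  then show ?thesis
    unfolding tensor_ideal_def by (subst t) (rule complex_vector.span_sum)
qed

locale finite_dimensional_hopf_algebra = hopf_algebra comult counit antipode
  for comult :: "'h::complex_algebra_1 \<Rightarrow> ('h, 'h) tensor"
    and counit :: "'h \<Rightarrow> complex"
    and antipode :: "'h \<Rightarrow> 'h" +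
  assumes fin: "finite_dimensional TYPE('h)"

context hopf_algebra
begin

lemmas hopf_clin = clin clinear_compose[OF comult_linear] clinear_compose[OF counit_linear]
  clinear_compose[OF antipode_linear]

text \<open>A trilinear \<open>F\<close> induces a linear map \<open>M\<close> on the triple tensor
  product; applying \<open>M\<close> to the axiom \<open>coassoc\<close> permits re-bracketing
  inside any Sweedler sum.\<close>

lemma sweedler_coassoc:
  assumes "\<And>b c. clinear (\<lambda>a. F a b c)" "\<And>a c. clinear (\<lambda>b. F a b c)" "\<And>a b. clinear (F a b)"
  shows "tensor_lift (\<lambda>a b. tensor_lift (\<lambda>c d. F c d b) (comult a)) (comult h) =
    tensor_lift (\<lambda>a b. tensor_lift (\<lambda>c d. F a c d) (comult b)) (comult h)"
proof -
  define M where "M = tensor_lift (\<lambda>a. tensor_lift (F a))"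
  have bilF: "cbilinear (F a)" for a
    using assms by (intro cbilinearI)
  have bilM: "cbilinear (\<lambda>a. tensor_lift (F a))"
    by (intro clin clinear_tensor_lift bilF assms)
  have linM: "clinear M"
    unfolding M_def by (intro clin bilM)
  have M: "M (a \<otimes>\<^sub>C (b \<otimes>\<^sub>C c)) = F a b c" for a b c
    by (simp add: M_def tensor_lift_tensor[OF bilM] tensor_lift_tensor[OF bilF])
  have id: "clinear (id :: 'x::complex_vector \<Rightarrow> 'x)"
    by (simp add: id_def clin)
  note map1 = tensor_map_tensor[OF comult_linear id] and map2 = tensor_map_tensor[OF id comult_linear]
  have bilA: "cbilinear (\<lambda>t c. tensor_lift (\<lambda>a b. a \<otimes>\<^sub>C (b \<otimes>\<^sub>C c)) t)"
    by (intro clin clinear_tensor_lift)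
  have linA: "clinear tensor_assoc"
    unfolding tensor_assoc_def by (intro clin bilA clinear_tensor_lift)
  have "M (tensor_assoc (tensor_map comult id t)) =
      tensor_lift (\<lambda>a b. tensor_lift (\<lambda>c d. F c d b) (comult a)) t" for t
  proof (rule tensor_linear_eqI)
    show "clinear (\<lambda>t. M (tensor_assoc (tensor_map comult id t)))"
      by (intro clinear_compose[OF linM] clinear_compose[OF linA] map1)
    have bil: "cbilinear (\<lambda>a b. tensor_lift (\<lambda>c d. F c d b) (comult a))"
      by (intro hopf_clin assms)
    then show "clinear (tensor_lift (\<lambda>a b. tensor_lift (\<lambda>c d. F c d b) (comult a)))"
      by (rule clinear_tensor_lift)
    fix a b
    show "M (tensor_assoc (tensor_map comult id (a \<otimes>\<^sub>C b))) =
      tensor_lift (\<lambda>a b. tensor_lift (\<lambda>c d. F c d b) (comult a)) (a \<otimes>\<^sub>C b)"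
      by (simp add: map1 tensor_assoc_def tensor_lift_tensor[OF bilA] tensor_lift_tensor[OF bil]
          tensor_lift_apply[OF linM] M)
  qed
  moreover have "M (tensor_map id comult t) =
      tensor_lift (\<lambda>a b. tensor_lift (\<lambda>c d. F a c d) (comult b)) t" for t
  proof (rule tensor_linear_eqI)
    show "clinear (\<lambda>t. M (tensor_map id comult t))"
      by (intro clinear_compose[OF linM] map2)
    have bil: "cbilinear (\<lambda>a b. tensor_lift (F a) (comult b))"
      by (intro hopf_clin assms)
    then show "clinear (tensor_lift (\<lambda>a b. tensor_lift (\<lambda>c d. F a c d) (comult b)))"
      by (rule clinear_tensor_lift)
    fix a b
    show "M (tensor_map id comult (a \<otimes>\<^sub>C b)) =
      tensor_lift (\<lambda>a b. tensor_lift (\<lambda>c d. F a c d) (comult b)) (a \<otimes>\<^sub>C b)"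
      by (simp add: map2 M_def tensor_lift_tensor[OF bilM] tensor_lift_tensor[OF bil])
  qed
  ultimately show ?thesis by (metis coassoc)
qed

end

context finite_dimensional_hopf_algebra
begin

text \<open>The Galois map \<open>a \<otimes> b \<mapsto> \<Sum> a1 \<otimes> a2 b\<close> is injective and preserves
  \<open>H \<otimes> K + K \<otimes> H\<close>, hence by finite dimension its inverse, which sends \<open>k \<otimes> 1\<close> to
  \<open>\<Sum> k1 \<otimes> S k2\<close>, preserves this space as well.\<close>

lemma biideal_antipode_closed:
  assumes sub: "csubspace K"
    and ideal: "\<And>x a. x \<in> K \<Longrightarrow> a * x \<in> K" "\<And>x a. x \<in> K \<Longrightarrow> x * a \<in> K"
    and coideal: "\<And>x. x \<in> K \<Longrightarrow> comult x \<in> tensor_ideal K"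
    and counit: "\<And>x. x \<in> K \<Longrightarrow> counit x = 0"
    and k: "k \<in> K"
  shows "antipode k \<in> K"
proof -
  define T where "T = tensor_lift (\<lambda>a b. tensor_lift (\<lambda>c d. c \<otimes>\<^sub>C (d * b)) (comult a))"
  \<comment> \<open>The candidate inverse. Only \<open>T' (T t) = t\<close> is computed; finite
    dimension turns the injectivity of \<open>T\<close> into surjectivity on the tensor
    ideal.\<close>
  define T' where "T' = tensor_lift (\<lambda>a b. tensor_lift (\<lambda>c d. c \<otimes>\<^sub>C (antipode d * b)) (comult a))"
  have bilT: "cbilinear (\<lambda>a b. tensor_lift (\<lambda>c d. c \<otimes>\<^sub>C (d * b)) (comult a))"
    by (intro hopf_clin)
  have bilT': "cbilinear (\<lambda>a b. tensor_lift (\<lambda>c d. c \<otimes>\<^sub>C (antipode d * b)) (comult a))"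
    by (intro hopf_clin)
  have linT: "clinear T" and linT': "clinear T'"
    unfolding T_def T'_def by (intro clinear_tensor_lift bilT bilT')+
  have T: "T (a \<otimes>\<^sub>C b) = tensor_lift (\<lambda>c d. c \<otimes>\<^sub>C (d * b)) (comult a)" for a b
    by (simp add: T_def tensor_lift_tensor[OF bilT])
  have T': "T' (a \<otimes>\<^sub>C b) = tensor_lift (\<lambda>c d. c \<otimes>\<^sub>C (antipode d * b)) (comult a)" for a b
    by (simp add: T'_def tensor_lift_tensor[OF bilT'])
  have "T' (T t) = t" for t
  proof (rule tensor_linear_eqI[of "\<lambda>t. T' (T t)"])
    show "clinear (\<lambda>t. T' (T t))" "clinear (\<lambda>t. t)"
      by (intro clinear_compose[OF linT'] linT clin)+
    fix a b
    have "T' (T (a \<otimes>\<^sub>C b)) = tensor_lift (\<lambda>c d.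
        tensor_lift (\<lambda>e f. e \<otimes>\<^sub>C (antipode f * (d * b))) (comult c)) (comult a)"
      by (simp add: T T' tensor_lift_apply[OF linT'])
    also have "\<dots> = tensor_lift (\<lambda>c d.
        tensor_lift (\<lambda>e f. c \<otimes>\<^sub>C (antipode e * (f * b))) (comult d)) (comult a)"
      by (rule sweedler_coassoc; intro hopf_clin)
    also have "\<dots> = tensor_lift (\<lambda>c d.
        c \<otimes>\<^sub>C (tensor_lift (\<lambda>e f. antipode e * f) (comult d) * b)) (comult a)"
    proof -
      have "c \<otimes>\<^sub>C (tensor_lift f t * b) = tensor_lift (\<lambda>x y. c \<otimes>\<^sub>C (f x y * b)) t"
        for c :: 'h and f :: "'h \<Rightarrow> 'h \<Rightarrow> 'h" and t
        by (rule tensor_lift_apply) (intro clin)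
      then show ?thesis
        by (simp add: mult.assoc)
    qed
    also have "\<dots> = tensor_lift (\<lambda>c d. (counit d *\<^sub>C c) \<otimes>\<^sub>C b) (comult a)"
      by (simp add: antipode_left mult_scaleC_left tensor_scale_left tensor_scale_right)
    also have "\<dots> = a \<otimes>\<^sub>C b"
      using tensor_lift_apply[of "\<lambda>x. x \<otimes>\<^sub>C b" "\<lambda>c d. counit d *\<^sub>C c" "comult a"]
      by (simp add: counit_right clin)
    finally show "T' (T (a \<otimes>\<^sub>C b)) = a \<otimes>\<^sub>C b" .
  qed
  then have T'T: "T' (T t) = t" for t .
  have inj: "inj T"
    by (metis T'T injI)
  let ?W = "tensor_ideal K"
  have subW: "csubspace ?W"
    by (simp add: tensor_ideal_def)
  have W1: "a \<otimes>\<^sub>C y \<in> ?W" and W2: "y \<otimes>\<^sub>C a \<in> ?W" if "y \<in> K" for a y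
    unfolding tensor_ideal_def using that by (blast intro: complex_vector.span_base)+
  have W_mult: "tensor_lift (\<lambda>c d. c \<otimes>\<^sub>C (d * b)) t \<in> ?W" if "t \<in> ?W" for t b
  proof (rule clinear_span_into[OF that[unfolded tensor_ideal_def]])
    have bil: "cbilinear (\<lambda>c d. c \<otimes>\<^sub>C (d * b))"
      by (intro clin)
    then show "clinear (tensor_lift (\<lambda>c d. c \<otimes>\<^sub>C (d * b)))"
      by (rule clinear_tensor_lift)
    fix x assume "x \<in> {a \<otimes>\<^sub>C y |a y. y \<in> K} \<union> {y \<otimes>\<^sub>C a |a y. y \<in> K}"
    then show "tensor_lift (\<lambda>c d. c \<otimes>\<^sub>C (d * b)) x \<in> ?W"
      by (auto simp: tensor_lift_tensor[OF bil] W1 W2 ideal)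
  qed (rule subW)
  have "T t \<in> ?W" if "t \<in> ?W" for t
  proof (rule clinear_span_into[OF that[unfolded tensor_ideal_def] linT subW])
    fix x assume "x \<in> {a \<otimes>\<^sub>C y |a y. y \<in> K} \<union> {y \<otimes>\<^sub>C a |a y. y \<in> K}"
    then consider a y where "x = a \<otimes>\<^sub>C y" "y \<in> K" | a y where "x = y \<otimes>\<^sub>C a" "y \<in> K"
      by blast
    then show "T x \<in> ?W"
    proof cases
      case 1
      \<comment> \<open>Each summand ends in \<open>d * y\<close> with \<open>y\<close> in
        \<open>K\<close>, so the left ideal property suffices whatever \<open>comult a\<close>
        is.\<close>
      have "tensor_lift (\<lambda>c d. c \<otimes>\<^sub>C (d * y)) s \<in> ?W" for s
        unfolding tensor_lift_def free_lift_def using 1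
        by (intro complex_vector.subspace_sum[OF subW])
          (auto intro!: complex_vector.subspace_scale[OF subW] W1 ideal(1))
      then show ?thesis by (simp add: 1 T)
    next
      case 2
      then show ?thesis by (simp add: T W_mult coideal)
    qed
  qed
  then have "T ` ?W = ?W"
    by (intro clinear_inj_subspace_onto finite_dimensional_tensor fin linT inj subW) auto
  then obtain w where w: "w \<in> ?W" "T w = k \<otimes>\<^sub>C 1"
    using W2[OF k, of 1] by (metis imageE)
  \<comment> \<open>The counit on the first factor sends the tensor ideal into \<open>K\<close>, and
    it sends \<open>w\<close>, the sum of \<open>k1 \<otimes> S k2\<close>, to
    \<open>S k\<close>.\<close>
  let ?E = "tensor_lift (\<lambda>a b. counit a *\<^sub>C b)"
  have bilE: "cbilinear (\<lambda>a b. counit a *\<^sub>C (b :: 'h))"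
    by (intro hopf_clin)
  have "?E w \<in> K"
  proof (rule clinear_span_into[OF w(1)[unfolded tensor_ideal_def] clinear_tensor_lift[OF bilE] sub])
    fix x assume "x \<in> {a \<otimes>\<^sub>C y |a y. y \<in> K} \<union> {y \<otimes>\<^sub>C a |a y. y \<in> K}"
    then show "?E x \<in> K"
      by (auto simp: tensor_lift_tensor[OF bilE] counit complex_vector.subspace_scale[OF sub]
          complex_vector.subspace_0[OF sub])
  qed
  also have "?E w = ?E (T' (k \<otimes>\<^sub>C 1))"
    using T'T w(2) by metis
  also have "\<dots> = tensor_lift (\<lambda>a b. counit a *\<^sub>C antipode b) (comult k)"
    by (simp add: T' tensor_lift_apply[OF clinear_tensor_lift[OF bilE]] tensor_lift_tensor[OF bilE])
  also have "\<dots> = antipode k"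
    using tensor_lift_apply[OF antipode_linear, of "\<lambda>a b. counit a *\<^sub>C b" "comult k"]
    by (simp add: counit_left clinear_scale[OF antipode_linear])
  finally show ?thesis .
qed

lemma hopf_ideal_biideal:
  assumes "csubspace K"
    and "\<And>x a. x \<in> K \<Longrightarrow> a * x \<in> K" "\<And>x a. x \<in> K \<Longrightarrow> x * a \<in> K"
    and "\<And>x. x \<in> K \<Longrightarrow> comult x \<in> tensor_ideal K"
    and "\<And>x. x \<in> K \<Longrightarrow> counit x = 0"
  shows "hopf_ideal K"
  using assms biideal_antipode_closed[OF assms]
  unfolding hopf_ideal_def tensor_ideal_def complex_vector.span_Un by auto

end

section \<open>Hopf actions on vertex algebras\<close>

context vertex_algebra
begin

lemma Y_right: "clinear g \<Longrightarrow> clinear (\<lambda>x. Y u n (g x))"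
  using Y_bilinear[of n] by (rule cbilinear_right)

lemma Y_left: "clinear g \<Longrightarrow> clinear (\<lambda>x. Y (g x) n v)"
  using Y_bilinear[of n] by (rule cbilinear_left)

lemma Y_zero: "Y 0 n v = 0" "Y u n 0 = 0"
  using clinear_zero[OF Y_left[OF clinear_ident]] clinear_zero[OF Y_right[OF clinear_ident]] by auto

text \<open>The coefficient of \<open>z0^(-r-1) z1^0 z2^(-1)\<close> in the Jacobi identity on the vacuum.\<close>

lemma skew_symmetry:
  assumes "\<And>n. n \<ge> r + int M \<Longrightarrow> Y u n v = 0"
  shows "- ((- 1) powi r *\<^sub>C Y v r u) =
    (\<Sum>i<M. (- 1) ^ i *\<^sub>C Y (Y u (r + int i) v) (- 1 - int i) vac)"
proof -
  let ?p = "(- r - 1, 0, - 1) :: int \<times> int \<times> int"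
  \<comment> \<open>The delta series contains only powers \<open>z2^k\<close> with
    \<open>k >= 0\<close>, and for these \<open>v_k\<close> annihilates the vacuum, so the first
    product contributes nothing.\<close>
  have "(\<lambda>(i, j, k). delta_z1_z2 (i, j, k) *\<^sub>C
      (if - r - 1 - i = 0 then Y u (- (0 - j) - 1) (Y v (- (- 1 - k) - 1) vac) else 0)) = (\<lambda>_. 0)"
    by (auto simp: fun_eq_iff delta_z1_z2_def binom_coeff_def creation Y_zero)
  then have 1: "series3_mult delta_z1_z2
      (\<lambda>(a, b, c). if a = 0 then Y u (- b - 1) (Y v (- c - 1) vac) else 0) ?p = 0"
    by (simp add: series3_mult_def)
  have "series3_mult delta_z2_z1
      (\<lambda>(a, b, c). if a = 0 then Y v (- c - 1) (Y u (- b - 1) vac) else 0) ?p =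
    Sum_any (\<lambda>(i, j, k). delta_z2_z1 (i, j, k) *\<^sub>C
      (if - r - 1 - i = 0 then Y v (- (- 1 - k) - 1) (Y u (- (0 - j) - 1) vac) else 0))"
    by (simp add: series3_mult_def)
  also have "\<dots> = (\<Sum>(i, j, k)\<in>{(- r - 1, 0, r)}. delta_z2_z1 (i, j, k) *\<^sub>C
      (if - r - 1 - i = 0 then Y v (- (- 1 - k) - 1) (Y u (- (0 - j) - 1) vac) else 0))"
  proof (rule Sum_any.expand_superset)
    \<comment> \<open>The delta series has only nonnegative powers \<open>z1^j\<close>; creation
      kills \<open>j > 0\<close> and leaves \<open>Y u (- 1) vac = u\<close> at
      \<open>j = 0\<close>.\<close>
    have "Y u (j - 1) vac = 0" if "j > 0" for j
      using that by (intro creation) auto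
    then show "{a. (case a of (i, j, k) \<Rightarrow> delta_z2_z1 (i, j, k) *\<^sub>C
      (if - r - 1 - i = 0 then Y v (- (- 1 - k) - 1) (Y u (- (0 - j) - 1) vac) else 0)) \<noteq> 0}
      \<subseteq> {(- r - 1, 0, r)}"
      by (auto simp: delta_z2_z1_def binom_coeff_def Y_zero split: if_splits)
        (metis Y_zero(2) complex_vector.scale_zero_right order_le_less)+
  qed simp
  also have "\<dots> = (- 1) powi r *\<^sub>C Y v r u"
    by (simp add: delta_z2_z1_def binom_coeff_def creation)
  finally have 2: "series3_mult delta_z2_z1
      (\<lambda>(a, b, c). if a = 0 then Y v (- c - 1) (Y u (- b - 1) vac) else 0) ?p =
    (- 1) powi r *\<^sub>C Y v r u" .
  \<comment> \<open>A power \<open>z0^i\<close> with \<open>i >= 0\<close> and no \<open>z1\<close>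
    forces \<open>z2^(-1-i)\<close>, with coefficient \<open>(-1)^i\<close> times
    \<open>i choose i\<close>. Truncation bounds \<open>i\<close> by \<open>M\<close>.\<close>
  let ?s = "\<lambda>i. (int i, 0 :: int, - 1 - int i)"
  have "series3_mult delta_z1_z0
      (\<lambda>(a, b, c). if b = 0 then Y (Y u (- a - 1) v) (- c - 1) vac else 0) ?p =
    Sum_any (\<lambda>(i, j, k). delta_z1_z0 (i, j, k) *\<^sub>C
      (if 0 - j = 0 then Y (Y u (- (- r - 1 - i) - 1) v) (- (- 1 - k) - 1) vac else 0))"
    by (simp add: series3_mult_def)
  also have "\<dots> = (\<Sum>(i, j, k)\<in>?s ` {..<M}. delta_z1_z0 (i, j, k) *\<^sub>C
      (if 0 - j = 0 then Y (Y u (- (- r - 1 - i) - 1) v) (- (- 1 - k) - 1) vac else 0))"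
  proof (rule Sum_any.expand_superset)
    have "(i, j, k) \<in> ?s ` {..<M}"
      if "delta_z1_z0 (i, j, k) *\<^sub>C
      (if 0 - j = 0 then Y (Y u (- (- r - 1 - i) - 1) v) (- (- 1 - k) - 1) vac else 0) \<noteq> 0" for i j k
    proof -
      have j: "j = 0" "Y u (r + i) v \<noteq> 0" "0 \<le> i" "k = - 1 - i"
        using that by (auto simp: delta_z1_z0_def binom_coeff_def Y_zero algebra_simps split: if_splits)
      then have "i < int M"
        using assms[of "r + i"] by force
      with j show ?thesis
        by (intro image_eqI[of _ _ "nat i"]) auto
    qed
    then show "{a. (case a of (i, j, k) \<Rightarrow> delta_z1_z0 (i, j, k) *\<^sub>C
      (if 0 - j = 0 then Y (Y u (- (- r - 1 - i) - 1) v) (- (- 1 - k) - 1) vac else 0)) \<noteq> 0}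
      \<subseteq> ?s ` {..<M}"
      by auto
  qed simp
  also have "\<dots> = (\<Sum>i<M. (- 1) ^ i *\<^sub>C Y (Y u (r + int i) v) (- 1 - int i) vac)"
  proof -
    have "of_nat i gchoose i = (1 :: complex)" for i
      by (simp flip: binomial_gbinomial)
    moreover have "inj_on ?s {..<M}"
      by (auto simp: inj_on_def)
    ultimately show ?thesis
      by (simp add: sum.reindex delta_z1_z0_def binom_coeff_def algebra_simps)
  qed
  finally have 3: "series3_mult delta_z1_z0
      (\<lambda>(a, b, c). if b = 0 then Y (Y u (- a - 1) v) (- c - 1) vac else 0) ?p =
    (\<Sum>i<M. (- 1) ^ i *\<^sub>C Y (Y u (r + int i) v) (- 1 - int i) vac)" .
  show ?thesis
    using jacobi[of u v vac ?p] unfolding 1 2 3 by simp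
qed

lemma pi2_tensor_lift: "pi2 (tensor_lift (\<lambda>a b. f a b \<otimes>\<^sub>C g a b) t) k =
  tensor_lift (\<lambda>a b. Y (f a b) (- k - 1) (g a b)) t"
  unfolding pi2_def
  by (simp add: tensor_lift_apply[OF clinear_tensor_lift[OF Y_bilinear]]
      tensor_lift_tensor[OF Y_bilinear])

end

context module_vertex_algebra
begin

lemma act_left: "clinear g \<Longrightarrow> clinear (\<lambda>x. act (g x) v)"
  by (rule cbilinear_left[OF act_bilinear])

lemma act_right: "clinear g \<Longrightarrow> clinear (\<lambda>x. act h (g x))"
  by (rule cbilinear_right[OF act_bilinear])

text \<open>The vacuum turns the second Sweedler factor into its counit, which collapses the sum to
  \<open>h\<close>. As \<open>Y x (- 1 - i) vac\<close> is \<open>D^i x / i!\<close>, this is how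
  \<open>H\<close> commutes with the translation operator \<open>D\<close>.\<close>

lemma act_Y_vac: "act h (Y x n vac) = Y (act h x) n vac"
proof -
  have lin: "clinear (\<lambda>a. Y (act a x) n vac)"
    by (intro Y_left act_left clin)
  have "act h (Y x n vac) = tensor_lift (\<lambda>a b. Y (act (counit b *\<^sub>C a) x) n vac) (comult h)"
    using clinear_scale[OF lin] clinear_scale[OF Y_right[OF clinear_ident]]
    by (simp add: act_Y act_vac)
  also have "\<dots> = Y (act h x) n vac"
    using tensor_lift_apply[OF lin, of "\<lambda>a b. counit b *\<^sub>C a" "comult h"]
    by (simp add: counit_right)
  finally show ?thesis .
qed

text \<open>The number of terms in skew symmetry depends on the two vectors. A claim about all large
  \<open>M\<close> survives addition, with the larger of the two bounds, and so reaches arbitrary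
  tensors.\<close>

lemma skew_symmetry_tensor:
  "\<exists>N. \<forall>M\<ge>N. - ((- 1) powi r *\<^sub>C tensor_lift (\<lambda>a b. Y (act b v) r (act a u)) t) =
    (\<Sum>i<M. (- 1) ^ i *\<^sub>C
      Y (tensor_lift (\<lambda>a b. Y (act a u) (r + int i) (act b v)) t) (- 1 - int i) vac)"
proof (induction t rule: tensor_induct)
  case (pure a b)
  have bil: "cbilinear (\<lambda>a b. Y (act b v) r (act a u))"
    "cbilinear (\<lambda>a b. Y (act a u) m (act b v))" for m
    by (intro clin Y_left Y_right act_left)+
  obtain N where N: "\<And>n. n \<ge> N \<Longrightarrow> Y (act a u) n (act b v) = 0"
    using truncation by blast
  show ?case
  proof (intro exI[of _ "nat (N - r)"] allI impI)
    fix M assume "nat (N - r) \<le> M"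
    then show "- ((- 1) powi r *\<^sub>C tensor_lift (\<lambda>a b. Y (act b v) r (act a u)) (a \<otimes>\<^sub>C b)) =
      (\<Sum>i<M. (- 1) ^ i *\<^sub>C
        Y (tensor_lift (\<lambda>a b. Y (act a u) (r + int i) (act b v)) (a \<otimes>\<^sub>C b)) (- 1 - int i) vac)"
      using N by (simp add: tensor_lift_tensor[OF bil(1)] tensor_lift_tensor[OF bil(2)] skew_symmetry)
  qed
next
  case (add s t)
  then obtain N N' where N: "\<forall>M\<ge>N. - ((- 1) powi r *\<^sub>C tensor_lift (\<lambda>a b. Y (act b v) r (act a u)) s) =
    (\<Sum>i<M. (- 1) ^ i *\<^sub>C
      Y (tensor_lift (\<lambda>a b. Y (act a u) (r + int i) (act b v)) s) (- 1 - int i) vac)"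
    "\<forall>M\<ge>N'. - ((- 1) powi r *\<^sub>C tensor_lift (\<lambda>a b. Y (act b v) r (act a u)) t) =
    (\<Sum>i<M. (- 1) ^ i *\<^sub>C
      Y (tensor_lift (\<lambda>a b. Y (act a u) (r + int i) (act b v)) t) (- 1 - int i) vac)"
    by blast
  have lin: "clinear (tensor_lift (\<lambda>a b. Y (act b v) r (act a u)))"
    "clinear (\<lambda>x. Y (tensor_lift (\<lambda>a b. Y (act a u) m (act b v)) x) n vac)" for m n
    by (intro clin clinear_tensor_lift Y_left Y_right act_left)+
  show ?case
    unfolding clinear_add[OF lin(1)] clinear_add[OF lin(2)] scaleC_add_right sum.distrib
      minus_add_distrib
    using N by (intro exI[of _ "max N N'"]) auto
qed

text \<open>Applying \<open>h\<close> to both sides of skew symmetry, and using that \<open>h\<close> commutes with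
  \<open>x \<mapsto> x_n 1\<close>.\<close>

lemma act_Y_flip: "tensor_lift (\<lambda>a b. Y (act b v) r (act a u)) (comult h) =
  tensor_lift (\<lambda>a b. Y (act a v) r (act b u)) (comult h)"
proof -
  obtain N where N: "\<forall>M\<ge>N. - ((- 1) powi r *\<^sub>C tensor_lift (\<lambda>a b. Y (act b v) r (act a u)) (comult h)) =
    (\<Sum>i<M. (- 1) ^ i *\<^sub>C
      Y (tensor_lift (\<lambda>a b. Y (act a u) (r + int i) (act b v)) (comult h)) (- 1 - int i) vac)"
    using skew_symmetry_tensor by blast
  obtain N' where N': "\<And>n. n \<ge> N' \<Longrightarrow> Y u n v = 0"
    using truncation by blast
  \<comment> \<open>Long enough both for the tensor identity and for skew symmetry of
    \<open>u\<close> and \<open>v\<close> before \<open>h\<close> acts.\<close>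
  define M where "M = max N (nat (N' - r))"
  note act_lin = act_right[OF clinear_ident, of h]
  have "- ((- 1) powi r *\<^sub>C tensor_lift (\<lambda>a b. Y (act b v) r (act a u)) (comult h)) =
    (\<Sum>i<M. (- 1) ^ i *\<^sub>C act h (Y (Y u (r + int i) v) (- 1 - int i) vac))"
    using N by (simp add: M_def act_Y_vac act_Y[of h u _ v])
  also have "\<dots> = act h (- ((- 1) powi r *\<^sub>C Y v r u))"
    by (subst skew_symmetry[of r M])
      (auto simp: M_def N' clinear_sum[OF act_lin] clinear_scale[OF act_lin])
  also have "\<dots> = - ((- 1) powi r *\<^sub>C tensor_lift (\<lambda>a b. Y (act a v) r (act b u)) (comult h))"
    using clinear_diff[OF act_lin, of 0] by (simp add: clinear_zero[OF act_lin] clinear_scale[OF act_lin] act_Y)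
  finally show ?thesis
    by (simp add: complex_vector.scale_left_imp_eq)
qed

text \<open>After \<open>pi2\<close> the first identity is \<open>act_Y_flip\<close> in each mode,
  and the second is \<open>act h\<close> applied to \<open>Y u n v\<close>; injectivity lifts both
  back to tensors.\<close>

lemma
  assumes "pi2_injective"
  shows act_comult_flip: "tensor_lift (\<lambda>a b. act b u \<otimes>\<^sub>C act a v) (comult h) =
      tensor_lift (\<lambda>a b. act a u \<otimes>\<^sub>C act b v) (comult h)"
    and act_comult_zero: "(\<And>v. act h v = 0) \<Longrightarrow>
      tensor_lift (\<lambda>a b. act a u \<otimes>\<^sub>C act b v) (comult h) = 0"
proof -
  have inj: "s = t" if "\<And>k. pi2 s k = pi2 t k" for s t
  proof -
    have "pi2 s = pi2 t"
      using that by (rule ext)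
    then show ?thesis
      using assms unfolding pi2_injective_def by (rule injD[rotated])
  qed
  show "tensor_lift (\<lambda>a b. act b u \<otimes>\<^sub>C act a v) (comult h) =
      tensor_lift (\<lambda>a b. act a u \<otimes>\<^sub>C act b v) (comult h)"
    by (rule inj) (simp add: pi2_tensor_lift act_Y_flip)
  have "pi2 0 k = 0" for k
    unfolding pi2_def by (rule clinear_zero[OF clinear_tensor_lift[OF Y_bilinear]])
  then show "tensor_lift (\<lambda>a b. act a u \<otimes>\<^sub>C act b v) (comult h) = 0" if "\<And>v. act h v = 0"
    by (intro inj) (simp add: pi2_tensor_lift that flip: act_Y)
qed

end

locale finite_dimensional_module_vertex_algebra =
  module_vertex_algebra comult counit antipode vac Y act +
  finite_dimensional_hopf_algebra comult counit antipode
  for comult :: "'h::complex_algebra_1 \<Rightarrow> ('h, 'h) tensor"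
    and counit :: "'h \<Rightarrow> complex"
    and antipode :: "'h \<Rightarrow> 'h"
    and vac :: "'v::complex_vector"
    and Y :: "'v \<Rightarrow> int \<Rightarrow> 'v \<Rightarrow> 'v"
    and act :: "'h \<Rightarrow> 'v \<Rightarrow> 'v"
begin

text \<open>When \<open>V = 0\<close>, the kernel of the action is \<open>H\<close>, on which the counit does not vanish;
  the augmentation ideal takes its place.\<close>

lemma inner_faithful_imp_faithful:
  assumes "pi2_injective" "inner_faithful"
  shows "vac \<noteq> 0 \<Longrightarrow> {h. \<forall>v. act h v = 0} = {0}"
    and "vac = 0 \<Longrightarrow> {h. counit h = 0} = {0}"
proof -
  note lin = act_left[OF clinear_ident] and lin' = act_right[OF clinear_ident]
  let ?K = "{h. \<forall>v. act h v = 0}"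
  show "?K = {0}" if "vac \<noteq> 0"
  proof (rule ccontr)
    assume "?K \<noteq> {0}"
    moreover have "hopf_ideal ?K"
    proof (rule hopf_ideal_biideal)
      show "csubspace ?K"
        by (intro complex_vector.subspaceI)
          (auto simp: clinear_zero[OF lin] clinear_add[OF lin] clinear_scale[OF lin])
      show "a * x \<in> ?K" "x * a \<in> ?K" if "x \<in> ?K" for x a
        using that by (auto simp: act_mult clinear_zero[OF lin'])
      show "comult x \<in> tensor_ideal ?K" if "x \<in> ?K" for x
        using that assms(1)
        by (intro tensor_ideal_kernelI[OF fin act_bilinear] act_comult_zero) auto
      show "counit x = 0" if "x \<in> ?K" for x
        using that \<open>vac \<noteq> 0\<close> act_vac[of x] by simp
    qed
    ultimately show False
      using assms(2) unfolding inner_faithful_def by blast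
  qed
  let ?E = "{h. counit h = 0}"
  show "?E = {0}" if "vac = 0"
  proof (rule ccontr)
    assume "?E \<noteq> {0}"
    note clin_counit = clinear_zero[OF counit_linear] clinear_add[OF counit_linear]
      clinear_scale[OF counit_linear]
    \<comment> \<open>The counit makes \<complex> an \<open>H\<close>-module with kernel
      \<open>?E\<close>, so \<open>tensor_ideal_kernelI\<close> applies to this action as
      well.\<close>
    have bil: "cbilinear (\<lambda>a b. counit a * b)"
      by (intro hopf_clin)
    have "hopf_ideal ?E"
    proof (rule hopf_ideal_biideal)
      show "csubspace ?E"
        by (intro complex_vector.subspaceI) (auto simp: clin_counit scaleC_complex_def)
      show "a * x \<in> ?E" "x * a \<in> ?E" if "x \<in> ?E" for x a
        using that by (auto simp: counit_mult)
      have "tensor_lift (\<lambda>a b. (counit a * u) \<otimes>\<^sub>C (counit b * v)) (comult x) = 0"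
        if "counit x = 0" for x u v
      proof -
        have lin2: "clinear (\<lambda>b. u \<otimes>\<^sub>C (counit b * v))"
          by (intro hopf_clin)
        have move: "(c * u) \<otimes>\<^sub>C w = u \<otimes>\<^sub>C (c * w)" for c w :: complex
          using tensor_scale_left[of c u w] tensor_scale_right[of u c w]
          by (simp add: scaleC_complex_def)
        have "tensor_lift (\<lambda>a b. (counit a * u) \<otimes>\<^sub>C (counit b * v)) (comult x) =
          tensor_lift (\<lambda>a b. u \<otimes>\<^sub>C (counit (counit a *\<^sub>C b) * v)) (comult x)"
          by (simp add: clin_counit move scaleC_complex_def mult.assoc)
        also have "\<dots> = u \<otimes>\<^sub>C (counit x * v)"
          by (simp only: tensor_lift_apply[OF lin2, symmetric] counit_left)
        finally show ?thesis
          using that by (simp add: tensor_zero_right)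
      qed
      moreover have "{h. \<forall>v. counit h * v = 0} = ?E"
        by (auto dest: spec[of _ 1])
      ultimately show "comult x \<in> tensor_ideal ?E" if "x \<in> ?E" for x
        using tensor_ideal_kernelI[OF fin bil, of "comult x"] that by simp
    qed simp
    \<comment> \<open>With \<open>vac = 0\<close>, the axiom \<open>Y vac (- 1) w = w\<close> forces
      every vector to be 0, so even \<open>?E\<close> acts by zero.\<close>
    moreover have "act h v = 0" for h v
      using vacuum[of "- 1" "act h v"] that by (simp add: Y_zero)
    ultimately show False
      using assms(2) \<open>?E \<noteq> {0}\<close> unfolding inner_faithful_def by blast
  qed
qed

text \<open>If \<open>vac = 0\<close>, the augmentation ideal is zero and \<open>H\<close> consists
  of multiples of 1. Otherwise the difference of the two sides acts by zero on all
  \<open>u \<otimes> v\<close>, hence lies in the tensor ideal of the zero kernel.\<close>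

lemma cocommutative:
  assumes "pi2_injective" "inner_faithful"
  shows "tensor_lift (\<lambda>a b. b \<otimes>\<^sub>C a) (comult h) = comult h"
proof (cases "vac = 0")
  case True
  have "counit (h - counit h *\<^sub>C 1) = 0"
    by (simp add: clinear_diff[OF counit_linear] clinear_scale[OF counit_linear] counit_one
        scaleC_complex_def)
  then have "h - counit h *\<^sub>C 1 \<in> {h. counit h = 0}"
    by simp
  then have h: "h = counit h *\<^sub>C 1"
    unfolding inner_faithful_imp_faithful(2)[OF assms True] by simp
  have bil: "cbilinear (\<lambda>a b. b \<otimes>\<^sub>C (a :: 'h) :: ('h, 'h) tensor)"
    by (intro clin)
  then show ?thesis
    by (subst (1 2) h) (simp add: clinear_scale[OF comult_linear] comult_one
        clinear_scale[OF clinear_tensor_lift[OF bil]] tensor_lift_tensor[OF bil])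
next
  case False
  let ?f = "tensor_lift (\<lambda>a b. b \<otimes>\<^sub>C a) :: ('h, 'h) tensor \<Rightarrow> _"
  have "?f (comult h) - comult h \<in> tensor_ideal {h. \<forall>v. act h v = 0}"
  proof (rule tensor_ideal_kernelI[OF fin act_bilinear])
    fix u v
    let ?F = "tensor_lift (\<lambda>a b. act a u \<otimes>\<^sub>C act b v)"
    have bil: "cbilinear (\<lambda>a b. act a u \<otimes>\<^sub>C act b v)"
      by (intro clin act_left)
    then have lin: "clinear ?F"
      by (rule clinear_tensor_lift)
    show "?F (?f (comult h) - comult h) = 0"
      by (simp add: clinear_diff[OF lin] tensor_lift_apply[OF lin] tensor_lift_tensor[OF bil]
          act_comult_flip[OF assms(1)])
  qed
  then have "?f (comult h) - comult h \<in> cspan {0}"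
    unfolding inner_faithful_imp_faithful(1)[OF assms False] tensor_ideal_def
    by (auto simp: tensor_zero_left tensor_zero_right)
  then show ?thesis by simp
qed

end

section \<open>Grouplike and primitive elements\<close>

lemma sequence_in_span_of_predecessors:
  assumes "finite_dimensional TYPE('a::complex_vector)"
  shows "\<exists>n. (x :: nat \<Rightarrow> 'a) n \<in> cspan (x ` {..<n})"
proof (rule ccontr)
  assume "\<not> ?thesis"
  then have not: "x n \<notin> cspan (x ` {..<n})" for n
    by blast
  obtain S :: "'a set" where S: "finite S" "cspan S = UNIV"
    using assms by (auto simp: finite_dimensional_def)
  have "complex_vector.independent (x ` {..<n}) \<and> card (x ` {..<n}) = n" for n
  proof (induction n)
    case 0
    show ?case by (simp add: complex_vector.independent_empty)
  next
    case (Suc n)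
    have "x n \<notin> x ` {..<n}"
      using not[of n] complex_vector.span_base[of "x n" "x ` {..<n}"] by auto
    then show ?case
      using Suc complex_vector.independent_insertI[OF not[of n]]
      unfolding lessThan_Suc image_insert by (subst card_insert_disjoint) auto
  qed
  from this[of "Suc (card S)"] show False
    using complex_vector.independent_span_bound[OF S(1), of "x ` {..<Suc (card S)}"] S(2)
    by auto
qed

definition poly_apply :: "complex poly \<Rightarrow> ('a::complex_vector \<Rightarrow> 'a) \<Rightarrow> 'a \<Rightarrow> 'a"
  where "poly_apply p T v = (\<Sum>i\<le>degree p. coeff p i *\<^sub>C (T ^^ i) v)"

lemma poly_apply_superset:
  assumes "degree p \<le> n"
  shows "poly_apply p T v = (\<Sum>i\<le>n. coeff p i *\<^sub>C (T ^^ i) v)"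
  unfolding poly_apply_def using assms
  by (intro sum.mono_neutral_left) (auto simp: coeff_eq_0)

lemma poly_apply_add: "poly_apply (p + q) T v = poly_apply p T v + poly_apply q T v"
  using degree_add_le_max[of p q]
  by (simp add: poly_apply_superset[of _ "max (degree p) (degree q)"] scaleC_add_left sum.distrib)

lemma poly_apply_smult: "poly_apply (smult c p) T v = c *\<^sub>C poly_apply p T v"
  using degree_smult_le[of c p]
  by (simp add: poly_apply_superset[of _ "degree p"] complex_vector.scale_sum_right scaleC_scaleC)

lemma poly_apply_monom: "poly_apply (monom c n) T v = c *\<^sub>C (T ^^ n) v"
  using degree_monom_le[of c n]
  by (simp add: poly_apply_superset[of _ n] if_distrib[of "\<lambda>a. a *\<^sub>C _"] sum.delta' cong: if_cong)

lemma poly_apply_shift: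
  assumes "clinear T"
  shows "poly_apply (pCons 0 p) T v = T (poly_apply p T v)"
  using degree_pCons_le[of 0 p]
  by (simp add: poly_apply_superset[of _ "Suc (degree p)"] poly_apply_def sum.atMost_Suc_shift
      clinear_sum[OF assms] clinear_scale[OF assms] del: sum.atMost_Suc)

text \<open>Consider a nonzero polynomial \<open>p\<close> of least degree with
  \<open>p(T) h\<close> in \<open>C\<close>. It has a root \<open>z\<close>, and with
  \<open>p = (X - z) q\<close> the vector \<open>v = q(T) h\<close> lies outside \<open>C\<close> by
  minimality.\<close>

lemma eigenvector_modulo_subspace:
  assumes fin: "finite_dimensional TYPE('a::complex_vector)"
    and T: "clinear (T :: 'a \<Rightarrow> 'a)" and C: "csubspace C"
    and W: "csubspace W" "\<And>w. w \<in> W \<Longrightarrow> T w \<in> W"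
    and h: "h \<in> W" "h \<notin> C"
  obtains v z where "v \<in> W" "v \<notin> C" "T v - z *\<^sub>C v \<in> C"
proof -
  have iter: "(T ^^ i) h \<in> W" for i
    by (induction i) (simp_all add: h W)
  have poly_W: "poly_apply p T h \<in> W" for p
    unfolding poly_apply_def
    by (intro complex_vector.subspace_sum complex_vector.subspace_scale W iter)
  have main: "\<exists>v z. v \<in> W \<and> v \<notin> C \<and> T v - z *\<^sub>C v \<in> C"
    if "poly_apply p T h \<in> C" "p \<noteq> 0" for p
    using that
  proof (induction "degree p" arbitrary: p rule: less_induct)
    case less
    show ?case
    proof (cases "degree p = 0")
      case True
      then obtain c where "p = [:c:]" by (rule degree_eq_zeroE)
      then have "c \<noteq> 0" "c *\<^sub>C h \<in> C"
        using less.prems by (auto simp: poly_apply_def)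
      then have "h \<in> C"
        using complex_vector.subspace_scale[OF C, of "c *\<^sub>C h" "inverse c"]
        by (simp add: scaleC_scaleC scaleC_one)
      with h show ?thesis by simp
    next
      case False
      then obtain z where "poly p z = 0"
        using fundamental_theorem_of_algebra[of p] by (auto simp: constant_degree)
      then obtain q where q: "p = [:- z, 1:] * q"
        by (auto simp: poly_eq_0_iff_dvd)
      have "q \<noteq> 0" using q less.prems by auto
      then have deg: "degree q < degree p"
        using q by (simp add: degree_mult_eq del: mult_pCons_left)
      have "p = smult (- z) q + pCons 0 q"
        using q by simp
      then have eq: "poly_apply p T h = T (poly_apply q T h) - z *\<^sub>C poly_apply q T h"
        by (simp only: poly_apply_add poly_apply_smult poly_apply_shift[OF T]) simp
      show ?thesis
      proof (cases "poly_apply q T h \<in> C")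
        case True
        then show ?thesis using less.hyps deg \<open>q \<noteq> 0\<close> by blast
      next
        case False
        then show ?thesis using eq poly_W less.prems by metis
      qed
    qed
  qed
  obtain n where "(T ^^ n) h \<in> cspan ((\<lambda>i. (T ^^ i) h) ` {..<n})"
    using sequence_in_span_of_predecessors[OF fin, of "\<lambda>i. (T ^^ i) h"] by blast
  \<comment> \<open>The bound on the coefficients of \<open>p\<close> guarantees that
    \<open>X^n - p\<close>, which annihilates \<open>h\<close>, is not the zero polynomial.\<close>
  then have "\<exists>p. (\<forall>i\<ge>n. coeff p i = 0) \<and> poly_apply p T h = (T ^^ n) h"
  proof (induction rule: complex_vector.span_induct_alt)
    case base
    show ?case by (intro exI[of _ 0]) (simp add: poly_apply_def)
  next
    case (step c x y)
    then obtain i p where "i < n" "x = (T ^^ i) h" "\<forall>i\<ge>n. coeff p i = 0" "poly_apply p T h = y"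
      by auto
    then show ?case
      by (intro exI[of _ "monom c i + p"]) (simp add: poly_apply_add poly_apply_monom)
  qed
  then obtain p where p: "\<forall>i\<ge>n. coeff p i = 0" "poly_apply p T h = (T ^^ n) h"
    by blast
  let ?q = "monom 1 n + smult (- 1) p"
  have "poly_apply ?q T h = 0"
    unfolding poly_apply_add poly_apply_smult poly_apply_monom p(2) by (simp add: scaleC_one)
  then have "poly_apply ?q T h \<in> C"
    using C by (simp add: complex_vector.subspace_0)
  moreover have "coeff ?q n = 1"
    using p(1) by simp
  then have "?q \<noteq> 0"
    by (metis coeff_0 zero_neq_one)
  ultimately show thesis
    using main that by blast
qed

section \<open>Contractions, grouplike and primitive elements\<close>

locale cocommutative_hopf_algebra = finite_dimensional_hopf_algebra comult counit antipode
  for comult :: "'h::complex_algebra_1 \<Rightarrow> ('h, 'h) tensor"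
    and counit :: "'h \<Rightarrow> complex"
    and antipode :: "'h \<Rightarrow> 'h" +
  assumes cocomm: "tensor_lift (\<lambda>a b. b \<otimes>\<^sub>C a) (comult h) = comult h"

context hopf_algebra
begin

definition grouplikes :: "'h set"
  where "grouplikes = {g. comult g = g \<otimes>\<^sub>C g \<and> counit g = 1}"

definition contract :: "('h \<Rightarrow> complex) \<Rightarrow> 'h \<Rightarrow> 'h"
  where "contract f h = tensor_lift (\<lambda>a b. f a *\<^sub>C b) (comult h)"

lemma contract_bilinear: "clinear f \<Longrightarrow> cbilinear (\<lambda>a b. f a *\<^sub>C (b :: 'x::complex_vector))"
  by (intro clin)

lemma contract_linear: "clinear f \<Longrightarrow> clinear (contract f)"
  unfolding contract_def by (intro hopf_clin)

lemma contract_grouplike: "clinear f \<Longrightarrow> g \<in> grouplikes \<Longrightarrow> contract f g = f g *\<^sub>C g"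
  by (simp add: contract_def grouplikes_def tensor_lift_tensor[OF contract_bilinear])

lemma contract_counit: "contract counit h = h"
  by (simp add: contract_def counit_left)

text \<open>By coassociativity both sides are the sum of \<open>f(h1)\<close> times
  \<open>h2 \<otimes> h3\<close>.\<close>

lemma comult_contract:
  assumes f: "clinear f"
  shows "comult (contract f h) = tensor_lift (\<lambda>a b. contract f a \<otimes>\<^sub>C b) (comult h)"
proof -
  have "comult (contract f h) = tensor_lift (\<lambda>a b. f a *\<^sub>C tensor_lift (\<otimes>\<^sub>C) (comult b)) (comult h)"
    by (simp add: contract_def tensor_lift_apply[OF comult_linear] clinear_scale[OF comult_linear]
        tensor_lift_tensor_eq)
  also have "\<dots> = tensor_lift (\<lambda>a b. tensor_lift (\<lambda>c d. f a *\<^sub>C (c \<otimes>\<^sub>C d)) (comult b)) (comult h)"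
    by (simp add: tensor_lift_apply[OF clinear_scaled[OF clinear_ident]])
  also have "\<dots> = tensor_lift (\<lambda>a b. tensor_lift (\<lambda>c d. f c *\<^sub>C (d \<otimes>\<^sub>C b)) (comult a)) (comult h)"
    by (rule sweedler_coassoc[symmetric]; intro clin f)
  also have "\<dots> = tensor_lift (\<lambda>a b. contract f a \<otimes>\<^sub>C b) (comult h)"
  proof -
    have "contract f a \<otimes>\<^sub>C b = tensor_lift (\<lambda>c d. (f c *\<^sub>C d) \<otimes>\<^sub>C b) (comult a)" for a b :: 'h
      unfolding contract_def by (rule tensor_lift_apply) (intro clin)
    then show ?thesis by (simp add: tensor_scale_left)
  qed
  finally show ?thesis .
qed

lemma tensor_mult_pure: "tensor_mult (a \<otimes>\<^sub>C b) t = tensor_lift (\<lambda>c d. (a * c) \<otimes>\<^sub>C (b * d)) t"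
  for a b :: 'h
proof -
  have "cbilinear (\<lambda>a b. tensor_lift (\<lambda>c d. (a * c) \<otimes>\<^sub>C (b * d)) t)"
    by (intro clin)
  then show ?thesis
    by (simp add: tensor_mult_def tensor_lift_tensor)
qed

lemma tensor_mult_add: "tensor_mult (s + s') t = tensor_mult s t + tensor_mult s' t"
  for s s' :: "('h, 'h) tensor"
proof -
  have "cbilinear (\<lambda>a b. tensor_lift (\<lambda>c d. (a * c) \<otimes>\<^sub>C (b * d)) t)"
    by (intro clin)
  then show ?thesis
    unfolding tensor_mult_def by (intro clinear_add clinear_tensor_lift)
qed

lemma tensor_mult_pure_pure: "tensor_mult (a \<otimes>\<^sub>C b) (c \<otimes>\<^sub>C d) = (a * c) \<otimes>\<^sub>C (b * d)"
  for a b :: 'h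
proof -
  have "cbilinear (\<lambda>c d. (a * c) \<otimes>\<^sub>C (b * d))"
    by (intro clin)
  then show ?thesis
    by (simp add: tensor_mult_pure tensor_lift_tensor)
qed

lemma tensor_mult_assoc_pure:
  "tensor_mult (a \<otimes>\<^sub>C b) (tensor_mult (c \<otimes>\<^sub>C d) t) = tensor_mult ((a * c) \<otimes>\<^sub>C (b * d)) t"
  for a b c d :: 'h
proof -
  have bil: "cbilinear (\<lambda>c d. (a * c) \<otimes>\<^sub>C (b * d))" for a b :: 'h
    by (intro clin)
  show ?thesis
    by (simp add: tensor_mult_pure tensor_lift_apply[OF clinear_tensor_lift[OF bil]]
        tensor_lift_tensor[OF bil] mult.assoc)
qed

lemma one_grouplike: "1 \<in> grouplikes"
  by (simp add: grouplikes_def comult_one counit_one)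

lemma grouplikes_closed:
  assumes "g \<in> grouplikes"
  shows "g * antipode g = 1" "antipode g * g = 1" "antipode g \<in> grouplikes"
    and "h \<in> grouplikes \<Longrightarrow> g * h \<in> grouplikes"
proof -
  have bil: "cbilinear (\<lambda>a b. antipode a * b)" "cbilinear (\<lambda>a b. a * antipode b)"
    by (intro hopf_clin)+
  have g: "comult g = g \<otimes>\<^sub>C g" "counit g = 1"
    using assms by (simp_all add: grouplikes_def)
  show inv: "g * antipode g = 1" "antipode g * g = 1"
    using antipode_left[of g] antipode_right[of g]
    by (simp_all add: g tensor_lift_tensor[OF bil(1)] tensor_lift_tensor[OF bil(2)] scaleC_one)
  let ?i = "antipode g"
  \<comment> \<open>\<open>g \<otimes>\<^sub>C g\<close> has the right inverse
    \<open>comult ?i\<close> and the left inverse \<open>?i \<otimes>\<^sub>C ?i\<close>, so the two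
    agree.\<close>
  have "tensor_mult (g \<otimes>\<^sub>C g) (comult ?i) = 1 \<otimes>\<^sub>C 1"
    using comult_mult[of g ?i] by (simp add: inv comult_one g)
  then have "tensor_mult (?i \<otimes>\<^sub>C ?i) (tensor_mult (g \<otimes>\<^sub>C g) (comult ?i)) = ?i \<otimes>\<^sub>C ?i"
    by (simp add: tensor_mult_pure_pure)
  moreover have "tensor_mult (1 \<otimes>\<^sub>C 1) t = t" for t :: "('h, 'h) tensor"
    by (simp add: tensor_mult_pure tensor_lift_tensor_eq)
  ultimately have "comult ?i = ?i \<otimes>\<^sub>C ?i"
    by (simp add: tensor_mult_assoc_pure inv)
  moreover have "counit ?i = 1"
    using counit_mult[of g ?i] by (simp add: inv counit_one g)
  ultimately show "?i \<in> grouplikes"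
    by (simp add: grouplikes_def)
  show "g * h \<in> grouplikes" if "h \<in> grouplikes"
    using that g by (simp add: grouplikes_def comult_mult counit_mult tensor_mult_pure_pure)
qed

end

context finite_dimensional_hopf_algebra
begin

text \<open>As for independence of characters: expand \<open>g\<close> in a maximal independent set
  \<open>A\<close> of grouplikes not containing it, with coefficients \<open>r\<close>, and contract
  with the coordinate functional of \<open>x\<close> in \<open>A\<close>. This gives
  \<open>r x *\<^sub>C g = r x *\<^sub>C x\<close>, so all coefficients vanish, whereas
  \<open>counit g = 1\<close> excludes \<open>g = 0\<close>.\<close>

lemma independent_grouplikes: "complex_vector.independent grouplikes"
proof -
  obtain A where A: "A \<subseteq> grouplikes" "complex_vector.independent A" "grouplikes \<subseteq> cspan A"
    by (rule complex_vector.maximal_independent_subset[of grouplikes])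
  obtain B where B: "A \<subseteq> B" "complex_vector.independent B" "cspan B = UNIV"
    by (metis complex_vector.maximal_independent_subset_extend[of A UNIV] A(2) subset_UNIV top.extremum_uniqueI)
  obtain S :: "'h set" where S: "finite S" "cspan S = UNIV"
    using fin by (auto simp: finite_dimensional_def)
  have finA: "finite A"
    using complex_vector.independent_span_bound[OF S(1) A(2)] S(2) by auto
  have "g \<in> A" if g: "g \<in> grouplikes" for g
  proof (rule ccontr)
    assume "g \<notin> A"
    let ?r = "complex_vector.representation A g"
    have sum: "(\<Sum>a\<in>A. ?r a *\<^sub>C a) = g"
      using A g finA by (intro complex_vector.sum_representation_eq) auto
    have "?r x = 0" if "x \<in> A" for x
    proof -
      define f where "f = (\<lambda>y. complex_vector.representation B y x)"
      have f: "clinear f"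
        unfolding f_def by (rule clinear_representation[OF B(2,3)])
      have fA: "f a = (if a = x then 1 else 0)" if "a \<in> A" for a
        using that B by (auto simp: f_def complex_vector.representation_basis)
      have "f g *\<^sub>C g = contract f g"
        using contract_grouplike[OF f g] by simp
      also have "\<dots> = (\<Sum>a\<in>A. ?r a *\<^sub>C f a *\<^sub>C a)"
        using A(1) by (subst sum[symmetric])
          (auto simp: clinear_sum[OF contract_linear[OF f]] clinear_scale[OF contract_linear[OF f]]
            contract_grouplike[OF f] intro!: sum.cong)
      also have "\<dots> = (\<Sum>a\<in>A. if a = x then ?r a *\<^sub>C a else 0)"
        by (intro sum.cong) (auto simp: fA scaleC_one)
      also have "\<dots> = ?r x *\<^sub>C x"
        using finA \<open>x \<in> A\<close> by simp
      also have "f g = (\<Sum>a\<in>A. if a = x then ?r a else 0)"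
        by (subst sum[symmetric])
          (auto simp: clinear_sum[OF f] clinear_scale[OF f] fA scaleC_complex_def intro!: sum.cong)
      also have "\<dots> = ?r x"
        using finA \<open>x \<in> A\<close> by simp
      finally have "?r x *\<^sub>C g = ?r x *\<^sub>C x" .
      then show ?thesis
        using \<open>g \<notin> A\<close> \<open>x \<in> A\<close> by (metis complex_vector.scale_left_imp_eq)
    qed
    then have "g = 0" using sum by simp
    then show False
      using g by (simp add: grouplikes_def clinear_zero[OF counit_linear])
  qed
  with A show ?thesis by (metis subset_antisym subsetI)
qed

lemma finite_grouplikes: "finite grouplikes"
proof -
  obtain S :: "'h set" where "finite S" "cspan S = UNIV"
    using fin by (auto simp: finite_dimensional_def)
  then show ?thesis
    using complex_vector.independent_span_bound[OF _ independent_grouplikes] by blast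
qed

text \<open>Contraction with \<open>f\<close>, where \<open>f 1 = 0\<close> and \<open>f d = 1\<close>, acts on the powers of \<open>d\<close> like
  differentiation, up to terms of lower degree; this is impossible if \<open>d\<close> is algebraic.\<close>

lemma primitive_eq_0:
  assumes d: "comult d = d \<otimes>\<^sub>C 1 + 1 \<otimes>\<^sub>C d"
  shows "d = 0"
proof (rule ccontr)
  assume "d \<noteq> 0"
  have contract_d: "contract f d = f d *\<^sub>C 1 + f 1 *\<^sub>C d" if "clinear f" for f
    by (simp add: contract_def d clinear_add[OF clinear_tensor_lift[OF contract_bilinear[OF that]]]
        tensor_lift_tensor[OF contract_bilinear[OF that]])
  \<comment> \<open>Contraction with the counit is the identity, so in \<open>contract_d\<close>
    only this multiple of 1 is left over.\<close>
  have "counit d *\<^sub>C (1 :: 'h) = 0"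
    using contract_d[OF counit_linear] by (simp add: contract_counit counit_one scaleC_one)
  then have "counit d = 0"
    by simp
  have "d \<notin> cspan {1}"
  proof
    assume "d \<in> cspan {1}"
    then obtain c where "d = c *\<^sub>C 1"
      by (auto simp: complex_vector.span_singleton)
    with \<open>counit d = 0\<close> \<open>d \<noteq> 0\<close> show False
      by (simp add: clinear_scale[OF counit_linear] counit_one scaleC_complex_def)
  qed
  then obtain f where f: "clinear f" "f d = (1::complex)" "f 1 = 0"
    by (rule separating_functional) (simp add: complex_vector.span_base)
  \<comment> \<open>The polynomials in \<open>d\<close> of degree less than \<open>n\<close>; in
    particular \<open>P 0\<close> is zero.\<close>
  define P where "P n = cspan ((\<lambda>j. d ^ j) ` {..<n})" for n
  have P_sub: "csubspace (P n)" for n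
    by (simp add: P_def)
  have P_power: "d ^ j \<in> P n" if "j < n" for j n
    unfolding P_def using that by (intro complex_vector.span_base) auto
  have P_mono: "P m \<subseteq> P n" if "m \<le> n" for m n
    unfolding P_def using that by (intro complex_vector.span_mono) auto
  note P_add = complex_vector.subspace_add[OF P_sub] and P_scale = complex_vector.subspace_scale[OF P_sub]
  have P_d: "d * x \<in> P (Suc n)" if "x \<in> P n" for x n
  proof (rule clinear_span_into[OF that[unfolded P_def]])
    show "clinear (\<lambda>x. d * x)" by (intro clin)
    fix x assume "x \<in> (\<lambda>j. d ^ j) ` {..<n}"
    then show "d * x \<in> P (Suc n)"
      by (auto simp: power_Suc[symmetric] simp del: power_Suc intro!: P_power)
  qed (rule P_sub)
  have contract_d_mult: "contract f (d * x) = d * contract f x + contract (\<lambda>y. f (d * y)) x"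
    if f: "clinear f" for f x
  proof -
    have lin: "clinear (\<lambda>y. d * y)" by (intro clin)
    note bil = contract_bilinear[OF f]
    have "contract f (d * x) = tensor_lift (\<lambda>a b. f (d * a) *\<^sub>C b) (comult x) +
        tensor_lift (\<lambda>a b. f a *\<^sub>C (d * b)) (comult x)"
      unfolding contract_def comult_mult d tensor_mult_add tensor_mult_pure
        clinear_add[OF clinear_tensor_lift[OF bil]] tensor_lift_apply[OF clinear_tensor_lift[OF bil]]
        tensor_lift_tensor[OF bil] by simp
    also have "tensor_lift (\<lambda>a b. f a *\<^sub>C (d * b)) (comult x) = d * contract f x"
      unfolding contract_def tensor_lift_apply[OF lin] mult_scaleC_right ..
    finally show ?thesis
      by (simp add: contract_def add.commute)
  qed
  \<comment> \<open>The induction varies \<open>f\<close>: the product rule brings in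
    \<open>y \<mapsto> f (d * y)\<close>, whose value at 1 is \<open>f d\<close> and supplies one
    more copy of \<open>d ^ m\<close>. At \<open>m = 0\<close> the truncated exponent
    \<open>m - 1\<close> carries the coefficient 0.\<close>
  have contract_power: "\<exists>p\<in>P (m - 1).
      contract f (d ^ m) = f 1 *\<^sub>C d ^ m + (of_nat m * f d) *\<^sub>C d ^ (m - 1) + p"
    if "clinear f" for f m
    using that
  proof (induction m arbitrary: f)
    case 0
    show ?case
      using contract_grouplike[OF 0 one_grouplike] complex_vector.subspace_0[OF P_sub] by auto
  next
    case (Suc m)
    let ?f' = "\<lambda>y. f (d * y)"
    have f': "clinear ?f'"
      by (intro clinear_compose[OF Suc.prems] clin)
    obtain p where p: "p \<in> P (m - 1)"
      "contract f (d ^ m) = f 1 *\<^sub>C d ^ m + (of_nat m * f d) *\<^sub>C d ^ (m - 1) + p"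
      using Suc.IH[OF Suc.prems] by blast
    obtain p' where p': "p' \<in> P (m - 1)"
      "contract ?f' (d ^ m) = f d *\<^sub>C d ^ m + (of_nat m * ?f' d) *\<^sub>C d ^ (m - 1) + p'"
      using Suc.IH[OF f'] by auto
    let ?q = "d * p + ((of_nat m * ?f' d) *\<^sub>C d ^ (m - 1) + p')"
    have "(of_nat m * ?f' d) *\<^sub>C d ^ (m - 1) \<in> P m"
      by (cases m) (auto intro!: P_scale P_power complex_vector.subspace_0[OF P_sub])
    moreover have "p' \<in> P m"
      using p'(1) P_mono[of "m - 1" m] by auto
    moreover have "d * p \<in> P m"
    proof (cases m)
      case 0
      then show ?thesis using p(1) by (simp add: P_def)
    qed (use P_d[OF p(1)] in auto)
    ultimately have "?q \<in> P (Suc m - 1)"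
      by (simp add: P_add)
    moreover have "contract f (d ^ Suc m) =
        f 1 *\<^sub>C d ^ Suc m + (of_nat (Suc m) * f d) *\<^sub>C d ^ (Suc m - 1) + ?q"
    proof -
      have "(of_nat m * f d) *\<^sub>C (d * d ^ (m - 1)) = (of_nat m * f d) *\<^sub>C d ^ m"
        by (cases m) auto
      then have 1: "d * contract f (d ^ m) =
          f 1 *\<^sub>C d ^ Suc m + (of_nat m * f d) *\<^sub>C d ^ m + d * p"
        by (simp only: p(2) distrib_left mult_scaleC_right power_Suc)
      have 2: "(of_nat (Suc m) * f d) *\<^sub>C d ^ m = (of_nat m * f d) *\<^sub>C d ^ m + f d *\<^sub>C d ^ m"
        by (simp add: distrib_right scaleC_add_left add.commute)
      have "contract f (d ^ Suc m) = d * contract f (d ^ m) + contract ?f' (d ^ m)"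
        unfolding power_Suc by (rule contract_d_mult[OF Suc.prems])
      then show ?thesis
        unfolding 1 p'(2) diff_Suc_1 2 by (simp only: add.assoc add.left_commute)
    qed
    ultimately show ?case by blast
  qed
  \<comment> \<open>The degree of the minimal polynomial of \<open>d\<close>. Contracting the
    relation \<open>d ^ n \<in> P n\<close> will yield one of degree \<open>n - 1\<close>.\<close>
  define n where "n = (LEAST n. d ^ n \<in> P n)"
  have ex: "\<exists>n. d ^ n \<in> P n"
    unfolding P_def by (rule sequence_in_span_of_predecessors[OF fin])
  have n: "d ^ n \<in> P n"
    unfolding n_def using ex by (rule LeastI_ex)
  show False
  proof (cases n)
    case 0
    then show False using n by (simp add: P_def)
  next
    case (Suc m)
    have "contract f x \<in> P m" if "x \<in> P (Suc m)" for x
    proof (rule clinear_span_into[OF that[unfolded P_def] contract_linear[OF f(1)] P_sub])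
      fix x assume "x \<in> (\<lambda>j. d ^ j) ` {..<Suc m}"
      then obtain j where j: "x = d ^ j" "j \<le> m" by auto
      obtain p where p: "p \<in> P (j - 1)" "contract f (d ^ j) = of_nat j *\<^sub>C d ^ (j - 1) + p"
        using contract_power[OF f(1), of j] f by auto
      have "of_nat j *\<^sub>C d ^ (j - 1) \<in> P m"
        using j by (cases j) (auto intro!: P_scale P_power complex_vector.subspace_0[OF P_sub])
      moreover have "p \<in> P m"
        using p(1) P_mono[of "j - 1" m] j(2) by (meson diff_le_self le_trans subsetD)
      ultimately show "contract f x \<in> P m"
        unfolding j(1) p(2) by (rule P_add)
    qed
    then have 1: "contract f (d ^ Suc m) \<in> P m"
      using n Suc by simp
    obtain p where p: "p \<in> P m" "contract f (d ^ Suc m) = of_nat (Suc m) *\<^sub>C d ^ m + p"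
      using contract_power[OF f(1), of "Suc m"] f by auto
    have "of_nat (Suc m) *\<^sub>C d ^ m \<in> P m"
      using complex_vector.subspace_diff[OF P_sub 1 p(1)] p(2) by simp
    \<comment> \<open>Dividing by \<open>Suc m\<close> is where characteristic 0 enters.\<close>
    then have "inverse (of_nat (Suc m)) *\<^sub>C of_nat (Suc m) *\<^sub>C d ^ m \<in> P m"
      by (rule P_scale)
    moreover have "inverse (of_nat (Suc m)) * of_nat (Suc m) = (1 :: complex)"
      by (rule left_inverse) (rule of_nat_neq_0)
    ultimately have "d ^ m \<in> P m"
      by (simp only: scaleC_scaleC scaleC_one)
    then have "n \<le> m"
      unfolding n_def by (rule Least_le)
    with Suc show False by simp
  qed
qed

end

section \<open>Cocommutative Hopf algebras over the complex numbers\<close>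

context cocommutative_hopf_algebra
begin

lemma contract_right:
  assumes f: "clinear f"
  shows "tensor_lift (\<lambda>a b. f b *\<^sub>C a) (comult h) = contract f h"
proof -
  note bil = contract_bilinear[OF f]
  have "contract f h = tensor_lift (\<lambda>a b. f a *\<^sub>C b) (tensor_lift (\<lambda>a b. b \<otimes>\<^sub>C a) (comult h))"
    by (simp add: contract_def cocomm)
  also have "\<dots> = tensor_lift (\<lambda>a b. f b *\<^sub>C a) (comult h)"
    by (simp add: tensor_lift_apply[OF clinear_tensor_lift[OF bil]] tensor_lift_tensor[OF bil])
  finally show ?thesis by simp
qed

text \<open>Cocommutativity lets \<open>f\<close> be contracted on the right and \<open>g\<close> on
  the left; by coassociativity contractions on opposite sides commute.\<close>

lemma contract_commute:
  assumes f: "clinear f" and g: "clinear g"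
  shows "contract f (contract g h) = contract g (contract f h)"
proof -
  have bil: "cbilinear (\<lambda>a b. f b *\<^sub>C a)"
    by (intro clin f)
  have "contract f (contract g h) = tensor_lift (\<lambda>a b. f b *\<^sub>C a) (comult (contract g h))"
    by (simp add: contract_right[OF f])
  also have "\<dots> = tensor_lift (\<lambda>a b. f b *\<^sub>C contract g a) (comult h)"
    by (simp add: comult_contract[OF g] tensor_lift_apply[OF clinear_tensor_lift[OF bil]]
        tensor_lift_tensor[OF bil])
  also have "\<dots> = contract g (tensor_lift (\<lambda>a b. f b *\<^sub>C a) (comult h))"
    by (simp add: tensor_lift_apply[OF contract_linear[OF g]] clinear_scale[OF contract_linear[OF g]])
  finally show ?thesis
    by (simp add: contract_right[OF f])
qed

text \<open>Both sides evaluate \<open>f\<close> and \<open>g\<close> on the two factors of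
  \<open>comult h\<close>, whose order does not matter.\<close>

lemma functional_contract_commute:
  assumes f: "clinear f" and g: "clinear g"
  shows "f (contract g h) = g (contract f h)"
proof -
  have "f (contract g h) = f (tensor_lift (\<lambda>a b. g b *\<^sub>C a) (comult h))"
    by (simp add: contract_right[OF g])
  also have "\<dots> = tensor_lift (\<lambda>a b. g b * f a) (comult h)"
    by (simp add: tensor_lift_apply[OF f] clinear_scale[OF f] scaleC_complex_def)
  also have "\<dots> = g (contract f h)"
    by (simp add: contract_def tensor_lift_apply[OF g] clinear_scale[OF g] scaleC_complex_def
        mult.commute)
  finally show ?thesis .
qed

lemma comult_basis_expansion:
  assumes "finite B" "complex_vector.independent B" "cspan B = UNIV"
  shows "comult h = (\<Sum>e\<in>B. e \<otimes>\<^sub>C contract (\<lambda>x. complex_vector.representation B x e) h)"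
proof -
  have bil: "cbilinear (\<lambda>a b. b \<otimes>\<^sub>C (a :: 'h) :: ('h, 'h) tensor)"
    by (intro clin)
  have "comult h = (\<Sum>e\<in>B. contract (\<lambda>x. complex_vector.representation B x e) h \<otimes>\<^sub>C e)"
    using tensor_basis_expansion[OF assms, of "comult h"]
    by (simp add: contract_right[OF clinear_representation[OF assms(2,3)]])
  then have "tensor_lift (\<lambda>a b. b \<otimes>\<^sub>C a) (comult h) =
      (\<Sum>e\<in>B. e \<otimes>\<^sub>C contract (\<lambda>x. complex_vector.representation B x e) h)"
    by (simp add: clinear_sum[OF clinear_tensor_lift[OF bil]] tensor_lift_tensor[OF bil])
  then show ?thesis by (simp add: cocomm)
qed

text \<open>Since \<open>H\<close> is cocommutative, these subspaces are exactly its
  subcoalgebras.\<close>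

definition contract_stable :: "'h set \<Rightarrow> bool"
  where "contract_stable W \<longleftrightarrow> csubspace W \<and> (\<forall>f. clinear f \<longrightarrow> (\<forall>w\<in>W. contract f w \<in> W))"

lemma contract_stable_grouplikes: "contract_stable (cspan grouplikes)"
  unfolding contract_stable_def
proof (intro conjI allI impI ballI)
  fix f :: "'h \<Rightarrow> complex" and w
  assume f: "clinear f" and w: "w \<in> cspan grouplikes"
  show "contract f w \<in> cspan grouplikes"
    by (rule clinear_span_into[OF w contract_linear[OF f]])
      (auto simp: contract_grouplike[OF f] intro: complex_vector.span_scale complex_vector.span_base)
qed simp

text \<open>The contractions commute, so they have a common eigenvector modulo \<open>C\<close>: all elements of a
  minimal stable subspace above \<open>C\<close> are of this kind.\<close>

lemma common_eigenvector_modulo: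
  assumes C: "contract_stable C" and ne: "C \<noteq> UNIV"
  obtains h where "h \<notin> C" "\<And>f. clinear f \<Longrightarrow> \<exists>z. contract f h - z *\<^sub>C h \<in> C"
proof -
  obtain B :: "'h set" where B: "finite B" "complex_vector.independent B" "cspan B = UNIV"
    by (rule finite_dimensional_basis[OF fin])
  interpret fd: finite_dimensional_vector_space "scaleC :: _ \<Rightarrow> 'h \<Rightarrow> 'h" B
    using B by unfold_locales
  let ?Q = "\<lambda>W. contract_stable W \<and> C \<subset> W"
  have "?Q UNIV"
    using ne by (auto simp: contract_stable_def)
  then obtain W where W: "?Q W"
    "\<And>W'. ?Q W' \<Longrightarrow> complex_vector.dim W \<le> complex_vector.dim W'"
    using ex_has_least_nat[of ?Q UNIV complex_vector.dim] by blast
  have subC: "csubspace C" and subW: "csubspace W"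
    using C W(1) by (auto simp: contract_stable_def)
  obtain h where h: "h \<in> W" "h \<notin> C"
    using W(1) by auto
  show thesis
  proof (rule that[OF h(2)])
    fix f :: "'h \<Rightarrow> complex" assume f: "clinear f"
    note lin = contract_linear[OF f]
    have WW: "contract f w \<in> W" if "w \<in> W" for w
      using that W(1) f unfolding contract_stable_def by blast
    obtain v z where v: "v \<in> W" "v \<notin> C" "contract f v - z *\<^sub>C v \<in> C"
      by (rule eigenvector_modulo_subspace[OF fin lin subC subW WW h])
    \<comment> \<open>The eigenvectors modulo \<open>C\<close> for the eigenvalue \<open>z\<close>.
      Commuting contractions preserve this space and \<open>v\<close> makes it larger than
      \<open>C\<close>, so by minimality it contains the \<open>h\<close> that was fixed before
      \<open>f\<close>.\<close>
    let ?W = "{w \<in> W. contract f w - z *\<^sub>C w \<in> C}"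
    have lin': "clinear (\<lambda>w. contract f w - z *\<^sub>C w)"
      by (intro clin lin)
    have sub: "csubspace ?W"
      using clinear_add[OF lin'] clinear_scale[OF lin'] clinear_zero[OF lin'] subC subW
      by (intro complex_vector.subspaceI)
        (simp_all add: complex_vector.subspace_0 complex_vector.subspace_add
          complex_vector.subspace_scale)
    have "contract_stable ?W"
      unfolding contract_stable_def
    proof (intro conjI allI impI ballI sub)
      fix g :: "'h \<Rightarrow> complex" and w assume g: "clinear g" and w: "w \<in> ?W"
      note ling = contract_linear[OF g]
      have "contract f (contract g w) - z *\<^sub>C contract g w = contract g (contract f w - z *\<^sub>C w)"
        by (simp add: contract_commute[OF f g] clinear_diff[OF ling] clinear_scale[OF ling])
      then show "contract g w \<in> ?W"
        using w g C W(1) by (auto simp: contract_stable_def)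
    qed
    moreover have "C \<subseteq> ?W"
      using W(1) C f subC
      by (auto simp: contract_stable_def complex_vector.subspace_diff complex_vector.subspace_scale)
    ultimately have "?Q ?W"
      using v by blast
    then have "complex_vector.dim W \<le> complex_vector.dim ?W"
      by (rule W(2))
    then have "?W = W"
      by (intro fd.subspace_dim_equal sub subW) auto
    then show "\<exists>z. contract f h - z *\<^sub>C h \<in> C"
      using h(1) by blast
  qed
qed

text \<open>For \<open>x = g\<close> the product of \<open>c\<close> with the inverse of
  \<open>g\<close> is primitive, thus zero. Otherwise apply an \<open>f\<close> with
  \<open>f x = 1\<close> and \<open>f g = 0\<close> to either factor of \<open>comult c\<close>: the
  results agree by cocommutativity, and \<open>c\<close> is \<open>f c\<close> times
  \<open>x - g\<close>.\<close>

lemma skew_primitive_in_span: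
  assumes c: "comult c = c \<otimes>\<^sub>C g + x \<otimes>\<^sub>C c" and g: "g \<in> grouplikes" and x: "x \<in> grouplikes"
  shows "c \<in> cspan grouplikes"
proof (cases "x = g")
  case True
  let ?d = "antipode g * c"
  have "comult ?d = ?d \<otimes>\<^sub>C 1 + 1 \<otimes>\<^sub>C ?d"
  proof -
    have bil: "cbilinear (\<lambda>c d. (antipode g * c) \<otimes>\<^sub>C (antipode g * d))"
      by (intro clin)
    have "comult (antipode g) = antipode g \<otimes>\<^sub>C antipode g"
      using grouplikes_closed(3)[OF g] by (simp add: grouplikes_def)
    then show ?thesis
      by (simp add: comult_mult c True tensor_mult_pure clinear_add[OF clinear_tensor_lift[OF bil]]
          tensor_lift_tensor[OF bil] grouplikes_closed(2)[OF g])
  qed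
  then have "?d = 0"
    by (rule primitive_eq_0)
  then have "g * ?d = 0"
    by simp
  then have "c = 0"
    by (simp add: mult.assoc[symmetric] grouplikes_closed(1)[OF g])
  then show ?thesis
    by (simp add: complex_vector.span_zero)
next
  case False
  have "x \<notin> cspan {g}"
  proof
    assume "x \<in> cspan {g}"
    then obtain k where "x = k *\<^sub>C g"
      by (auto simp: complex_vector.span_singleton)
    then show False
      using False x g by (auto simp: grouplikes_def clinear_scale[OF counit_linear] scaleC_complex_def
          scaleC_one)
  qed
  then obtain f where f: "clinear f" "f x = (1::complex)" "f g = 0"
    by (rule separating_functional) (simp add: complex_vector.span_base)
  have bil: "cbilinear (\<lambda>a b. f a *\<^sub>C b)" "cbilinear (\<lambda>a b. f b *\<^sub>C a)"
    by (intro clin f)+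
  have "f c *\<^sub>C g + c = f c *\<^sub>C x"
    using contract_right[OF f(1), of c] f(2,3)
    by (simp add: contract_def c clinear_add[OF clinear_tensor_lift[OF bil(1)]]
        clinear_add[OF clinear_tensor_lift[OF bil(2)]] tensor_lift_tensor[OF bil(1)]
        tensor_lift_tensor[OF bil(2)] scaleC_one)
  then have "c = f c *\<^sub>C x - f c *\<^sub>C g"
    by (metis add_diff_cancel_left')
  then show ?thesis
    using g x by (metis complex_vector.span_base complex_vector.span_diff complex_vector.span_scale)
qed

text \<open>A common eigenvector \<open>h\<close> modulo the span of the grouplikes has
  \<open>\<Delta> h = h \<otimes> g + \<Sum> x \<otimes> c x\<close> with \<open>x\<close> ranging over the grouplikes. By coassociativity \<open>g\<close> is
  grouplike and the \<open>c x\<close> are skew-primitive, so the counit puts \<open>h\<close> into the span.\<close>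

lemma span_grouplikes: "cspan grouplikes = UNIV"
proof (rule ccontr)
  assume "cspan grouplikes \<noteq> UNIV"
  then obtain h where h: "h \<notin> cspan grouplikes"
    "\<And>f. clinear f \<Longrightarrow> \<exists>z. contract f h - z *\<^sub>C h \<in> cspan grouplikes"
    by (rule common_eigenvector_modulo[OF contract_stable_grouplikes]) blast
  let ?A = "insert h grouplikes"
  have indep: "complex_vector.independent ?A"
    using h(1) independent_grouplikes by (rule complex_vector.independent_insertI)
  obtain B where B: "?A \<subseteq> B" "complex_vector.independent B" "cspan B = UNIV"
    by (metis complex_vector.maximal_independent_subset_extend[of ?A UNIV] indep subset_UNIV top.extremum_uniqueI)
  obtain S :: "'h set" where S: "finite S" "cspan S = UNIV"
    using fin by (auto simp: finite_dimensional_def)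
  have finB: "finite B"
    using complex_vector.independent_span_bound[OF S(1) B(2)] S(2) by auto
  define dual where "dual e = (\<lambda>x. complex_vector.representation B x e)" for e
  have dual: "clinear (dual e)" for e
    unfolding dual_def by (rule clinear_representation[OF B(2,3)])
  have dual_basis: "dual e x = (if x = e then 1 else 0)" if "x \<in> B" for e x
    using that B by (simp add: dual_def complex_vector.representation_basis)
  define c where "c e = contract (dual e) h" for e
  \<comment> \<open>\<open>f (c e)\<close> equals the coordinate of \<open>contract f h\<close> at
    \<open>e\<close>, and this contraction lies in the span of \<open>?A\<close>.\<close>
  have "c e = 0" if "e \<in> B - ?A" for e
  proof (rule functional_eqI)
    fix f :: "'h \<Rightarrow> complex" assume f: "clinear f"
    obtain z where z: "contract f h - z *\<^sub>C h \<in> cspan grouplikes"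
      using h(2)[OF f] by blast
    have "contract f h \<in> cspan ?A"
      using z by (auto simp: complex_vector.span_breakdown_eq)
    then have "dual e (contract f h) \<in> {0}"
    proof (rule clinear_span_into[OF _ dual])
      show "dual e x \<in> {0}" if "x \<in> ?A" for x
        using that \<open>e \<in> B - ?A\<close> B(1) dual_basis[of x e] by auto
    qed simp
    then show "f (c e) = f 0"
      by (simp add: c_def functional_contract_commute[OF f dual] clinear_zero[OF f])
  qed
  then have sum_A: "(\<Sum>e\<in>B. F e (c e)) = F h (c h) + (\<Sum>x\<in>grouplikes. F x (c x))"
    if "\<And>e. F e 0 = 0" for F :: "'h \<Rightarrow> 'h \<Rightarrow> 'x::ab_group_add"
  proof -
    have "(\<Sum>e\<in>B. F e (c e)) = (\<Sum>e\<in>?A. F e (c e))"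
      using B(1) finB that \<open>\<And>e. e \<in> B - ?A \<Longrightarrow> c e = 0\<close>
      by (intro sum.mono_neutral_right) auto
    also have "\<dots> = F h (c h) + (\<Sum>x\<in>grouplikes. F x (c x))"
      using h(1) complex_vector.span_base by (subst sum.insert) (auto simp: finite_grouplikes)
    finally show ?thesis .
  qed
  have comult_h: "comult h = (\<Sum>e\<in>B. e \<otimes>\<^sub>C c e)"
    unfolding c_def dual_def by (rule comult_basis_expansion[OF finB B(2,3)])
  \<comment> \<open>Contraction with \<open>dual e\<close> acts on the first factors of
    \<open>comult h\<close>: it scales each grouplike and turns \<open>h\<close> into
    \<open>c e\<close>.\<close>
  have comult_c: "comult (c e) = c e \<otimes>\<^sub>C c h + (\<Sum>x\<in>grouplikes. dual e x *\<^sub>C (x \<otimes>\<^sub>C c x))" for e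
  proof -
    have bil: "cbilinear (\<lambda>a b. contract (dual e) a \<otimes>\<^sub>C b)"
      by (intro clin contract_linear dual)
    have "comult (c e) = (\<Sum>x\<in>B. contract (dual e) x \<otimes>\<^sub>C c x)"
      unfolding c_def[of e] comult_contract[OF dual] comult_h
      by (simp add: clinear_sum[OF clinear_tensor_lift[OF bil]] tensor_lift_tensor[OF bil])
    also have "\<dots> = contract (dual e) h \<otimes>\<^sub>C c h +
        (\<Sum>x\<in>grouplikes. contract (dual e) x \<otimes>\<^sub>C c x)"
      by (rule sum_A) (rule tensor_zero_right)
    finally show ?thesis
      by (simp add: c_def[symmetric] contract_grouplike[OF dual] tensor_scale_left)
  qed
  have h_notin: "h \<notin> grouplikes"
    using h(1) complex_vector.span_base by blast
  have "dual h x = 0" if "x \<in> grouplikes" for x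
    using that B(1) h_notin dual_basis[of x h] by auto
  then have "comult (c h) = c h \<otimes>\<^sub>C c h"
    using comult_c[of h] by simp
  \<comment> \<open>By symmetry this is the coordinate of \<open>contract counit h = h\<close> at
    \<open>h\<close>.\<close>
  moreover have "counit (c h) = 1"
    using B(1) dual_basis[of h h] functional_contract_commute[OF counit_linear dual, of h h]
    by (simp add: c_def contract_counit)
  ultimately have g: "c h \<in> grouplikes"
    by (simp add: grouplikes_def)
  have c_span: "c x \<in> cspan grouplikes" if x: "x \<in> grouplikes" for x
  proof (rule skew_primitive_in_span[OF _ g x])
    have "dual x y *\<^sub>C (y \<otimes>\<^sub>C c y) = (if y = x then x \<otimes>\<^sub>C c x else 0)" if "y \<in> grouplikes" for y
      using that B(1) dual_basis[of y x] by (auto simp: scaleC_one)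
    then have "(\<Sum>y\<in>grouplikes. dual x y *\<^sub>C (y \<otimes>\<^sub>C c y)) = x \<otimes>\<^sub>C c x"
      using x finite_grouplikes by simp
    then show "comult (c x) = c x \<otimes>\<^sub>C c h + x \<otimes>\<^sub>C c x"
      using comult_c[of x] by simp
  qed
  have bil: "cbilinear (\<lambda>a b. counit a *\<^sub>C (b :: 'h))"
    by (intro hopf_clin)
  have "h = tensor_lift (\<lambda>a b. counit a *\<^sub>C b) (\<Sum>e\<in>B. e \<otimes>\<^sub>C c e)"
    using counit_left[of h] unfolding comult_h by simp
  also have "\<dots> = (\<Sum>e\<in>B. counit e *\<^sub>C c e)"
    by (simp add: clinear_sum[OF clinear_tensor_lift[OF bil]] tensor_lift_tensor[OF bil])
  also have "\<dots> = counit h *\<^sub>C c h + (\<Sum>x\<in>grouplikes. counit x *\<^sub>C c x)"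
    by (rule sum_A) simp
  also have "\<dots> \<in> cspan grouplikes"
    by (intro complex_vector.span_add complex_vector.span_sum complex_vector.span_scale
        complex_vector.span_base[OF g] c_span)
  finally show False using h(1) by simp
qed

section \<open>The isomorphism with the group algebra of the grouplikes\<close>

definition grouplike_group :: "'h monoid"
  where "grouplike_group = \<lparr>carrier = grouplikes, monoid.mult = (*), one = 1\<rparr>"

lemma group_grouplike_group: "group grouplike_group"
proof (rule groupI)
  fix x assume "x \<in> carrier grouplike_group"
  then show "\<exists>y\<in>carrier grouplike_group. y \<otimes>\<^bsub>grouplike_group\<^esub> x = \<one>\<^bsub>grouplike_group\<^esub>"
    by (auto simp: grouplike_group_def intro!: bexI[of _ "antipode x"] grouplikes_closed)
qed (auto simp: grouplike_group_def mult.assoc one_grouplike intro!: grouplikes_closed)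

lemma inv_grouplike_group: "g \<in> grouplikes \<Longrightarrow> inv\<^bsub>grouplike_group\<^esub> g = antipode g"
  using group.inv_equality[OF group_grouplike_group, of "antipode g" g] grouplikes_closed[of g]
  by (simp add: grouplike_group_def)

definition coordinates :: "'h \<Rightarrow> 'h \<Rightarrow>\<^sub>0 complex"
  where "coordinates h = Poly_Mapping.Abs_poly_mapping (complex_vector.representation grouplikes h)"

lemma lookup_coordinates:
  "Poly_Mapping.lookup (coordinates h) = complex_vector.representation grouplikes h"
  unfolding coordinates_def
  using complex_vector.finite_representation[of grouplikes h]
  by (intro lookup_Abs_poly_mapping)

lemma keys_coordinates: "Poly_Mapping.keys (coordinates h) \<subseteq> grouplikes"
  using complex_vector.representation_ne_zero[of grouplikes h]
  by (auto simp: in_keys_iff lookup_coordinates)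

lemma clinear_coordinates: "clinear coordinates"
  by (intro clinearI poly_mapping_eqI)
    (simp_all add: lookup_coordinates lookup_add lookup_scaleC
      clinear_add[OF clinear_representation[OF independent_grouplikes span_grouplikes]]
      clinear_scale[OF clinear_representation[OF independent_grouplikes span_grouplikes]])

lemma coordinates_grouplike: "g \<in> grouplikes \<Longrightarrow> coordinates g = Poly_Mapping.single g 1"
  by (rule poly_mapping_eqI)
    (simp add: lookup_coordinates lookup_single when_def
      complex_vector.representation_basis[OF independent_grouplikes])

lemma sum_coordinates:
  "(\<Sum>x\<in>Poly_Mapping.keys (coordinates h). Poly_Mapping.lookup (coordinates h) x *\<^sub>C x) = h"
proof -
  have "Poly_Mapping.keys (coordinates h) = {b. complex_vector.representation grouplikes h b \<noteq> 0}"
    by (auto simp: in_keys_iff lookup_coordinates)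
  then show ?thesis
    using complex_vector.sum_nonzero_representation_eq[OF independent_grouplikes, of h]
    by (simp add: lookup_coordinates span_grouplikes)
qed

text \<open>The group algebra operations are sums over the support of the coordinates. This
  identifies such a sum with a linear map, so each clause of the isomorphism is checked on
  grouplikes only.\<close>

lemma linear_extension:
  assumes K: "clinear K" and u: "\<And>g. g \<in> grouplikes \<Longrightarrow> K g = u g"
  shows "(\<Sum>x\<in>Poly_Mapping.keys (coordinates h). Poly_Mapping.lookup (coordinates h) x *\<^sub>C u x) = K h"
proof -
  have "K h = (\<Sum>x\<in>Poly_Mapping.keys (coordinates h). Poly_Mapping.lookup (coordinates h) x *\<^sub>C K x)"
    by (subst sum_coordinates[symmetric, of h]) (simp only: clinear_sum[OF K] clinear_scale[OF K])
  also have "\<dots> = (\<Sum>x\<in>Poly_Mapping.keys (coordinates h). Poly_Mapping.lookup (coordinates h) x *\<^sub>C u x)"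
    using keys_coordinates[of h] by (intro sum.cong) (auto simp: u subset_iff)
  finally show ?thesis by simp
qed

lemma single_scaleC: "Poly_Mapping.single x (c :: complex) = c *\<^sub>C Poly_Mapping.single x 1"
  by (rule poly_mapping_eqI) (simp add: lookup_scaleC lookup_single when_def scaleC_complex_def)

lemma bij_coordinates: "bij_betw coordinates UNIV (ga_carrier grouplike_group)"
proof (rule bij_betw_imageI)
  show "inj coordinates"
    by (rule injI) (metis sum_coordinates)
  show "range coordinates = ga_carrier grouplike_group"
  proof (intro equalityI subsetI)
    fix p assume "p \<in> ga_carrier grouplike_group"
    then have p: "Poly_Mapping.keys p \<subseteq> grouplikes"
      by (simp add: ga_carrier_def grouplike_group_def)
    have "coordinates (\<Sum>x\<in>Poly_Mapping.keys p. Poly_Mapping.lookup p x *\<^sub>C x) =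
        (\<Sum>x\<in>Poly_Mapping.keys p. Poly_Mapping.lookup p x *\<^sub>C Poly_Mapping.single x 1)"
      using p by (auto simp: clinear_sum[OF clinear_coordinates] clinear_scale[OF clinear_coordinates]
          coordinates_grouplike intro!: sum.cong)
    also have "\<dots> = p"
      by (rule poly_mapping_eqI)
        (simp add: lookup_sum lookup_scaleC lookup_single when_def scaleC_complex_def in_keys_iff
          if_distrib cong: if_cong)
    finally show "p \<in> range coordinates" by (metis rangeI)
  qed (use keys_coordinates in \<open>auto simp: ga_carrier_def grouplike_group_def\<close>)
qed

lemma coordinates_mult: "coordinates (a * b) = ga_mult grouplike_group (coordinates a) (coordinates b)"
proof -
  let ?s = "\<lambda>x y. Poly_Mapping.single (x * y) (1 :: complex)"
  \<comment> \<open>Linear extension in \<open>b\<close> for a fixed grouplike \<open>x\<close>; the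
    extension in \<open>a\<close> follows.\<close>
  have grouplike: "(\<Sum>y\<in>Poly_Mapping.keys (coordinates b).
      Poly_Mapping.lookup (coordinates b) y *\<^sub>C ?s x y) = coordinates (x * b)" if "x \<in> grouplikes" for x
    by (rule linear_extension)
      (auto intro!: clinear_compose[OF clinear_coordinates] clin coordinates_grouplike
        grouplikes_closed that)
  have "ga_mult grouplike_group (coordinates a) (coordinates b) =
    (\<Sum>x\<in>Poly_Mapping.keys (coordinates a). Poly_Mapping.lookup (coordinates a) x *\<^sub>C
      (\<Sum>y\<in>Poly_Mapping.keys (coordinates b). Poly_Mapping.lookup (coordinates b) y *\<^sub>C ?s x y))"
    unfolding ga_mult_def complex_vector.scale_sum_right scaleC_scaleC
    by (simp add: grouplike_group_def single_scaleC[of _ "_ * _"])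
  also have "\<dots> = coordinates (a * b)"
    by (rule linear_extension)
      (auto intro!: clinear_compose[OF clinear_coordinates] clin simp: grouplike)
  finally show ?thesis by simp
qed

lemma is_group_algebra: is_group_algebra
proof -
  note coord_clin = clinear_compose[OF clinear_coordinates]
  have comult: "tensor_map coordinates coordinates (comult a) = ga_comult (coordinates a)" for a
    unfolding ga_comult_def
    by (rule linear_extension[symmetric])
      (auto intro!: clinear_compose[OF tensor_map_tensor(2)] clinear_coordinates comult_linear
        simp: grouplikes_def tensor_map_tensor(1)[OF clinear_coordinates clinear_coordinates]
          coordinates_grouplike[unfolded grouplikes_def])
  have counit: "counit a = ga_counit (coordinates a)" for a
    using linear_extension[OF counit_linear, of "\<lambda>_. 1" a]
    by (simp add: ga_counit_def grouplikes_def scaleC_complex_def)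
  have antipode: "coordinates (antipode a) = ga_antipode grouplike_group (coordinates a)" for a
  proof -
    have "ga_antipode grouplike_group (coordinates a) =
      (\<Sum>x\<in>Poly_Mapping.keys (coordinates a). Poly_Mapping.lookup (coordinates a) x *\<^sub>C
        Poly_Mapping.single (inv\<^bsub>grouplike_group\<^esub> x) 1)"
      by (simp add: ga_antipode_def flip: single_scaleC)
    also have "\<dots> = coordinates (antipode a)"
      by (rule linear_extension)
        (auto intro!: coord_clin antipode_linear
          simp: inv_grouplike_group coordinates_grouplike grouplikes_closed)
    finally show ?thesis by simp
  qed
  have "coordinates 1 = ga_one grouplike_group"
    by (simp add: coordinates_grouplike[OF one_grouplike] ga_one_def grouplike_group_def)
  then have "group_algebra_iso grouplike_group coordinates"
    unfolding group_algebra_iso_def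
    using clinear_coordinates bij_coordinates coordinates_mult comult counit antipode by blast
  then show ?thesis
    unfolding is_group_algebra_def using group_grouplike_group by blast
qed

end

theorem theorem5p5:
  fixes comult :: "'h::complex_algebra_1 \<Rightarrow> ('h, 'h) tensor"
    and counit :: "'h \<Rightarrow> complex"
    and antipode :: "'h \<Rightarrow> 'h"
    and vac :: "'v::complex_vector"
    and Y :: "'v \<Rightarrow> int \<Rightarrow> 'v \<Rightarrow> 'v"
    and act :: "'h \<Rightarrow> 'v \<Rightarrow> 'v"
  assumes "hopf_algebra comult counit antipode"
    and "finite_dimensional TYPE('h)"
    and "vertex_algebra vac Y"
    and "vertex_algebra.pi2_injective Y"
    and "module_vertex_algebra comult counit antipode vac Y act"
    and "module_vertex_algebra.inner_faithful comult counit antipode act"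
  shows "hopf_algebra.is_group_algebra comult counit antipode"
proof -
  interpret V: module_vertex_algebra comult counit antipode vac Y act
    by (rule assms(5))
  interpret V: finite_dimensional_module_vertex_algebra comult counit antipode vac Y act
    by unfold_locales (rule assms(2))
  interpret H: cocommutative_hopf_algebra comult counit antipode
    by unfold_locales (rule V.cocommutative[OF assms(4,6)])
  show ?thesis
    by (rule H.is_group_algebra)
qed

end
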